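(* Let $\gamma>0$, let $\mu,L>0$, let $N=nR$ with $n<N$, and let $F:\mathbb{R}^d\to\mathbb{R}$ and $f_1,\dots,f_N:\mathbb{R}^d\to\mathbb{R}$ satisfy: $\nabla F=\frac1N\sum_{i=1}^N\nabla f_i$; $F$ is continuously differentiable, $L$-smooth and $\mu$-strongly convex with minimiser $X_*$; for every $\boldsymbol\omega\subset\{1,\dots,N\}$ with $|\boldsymbol\omega|=n$, the function $f_{\boldsymbol\omega}=\frac1n\sum_{i\in\boldsymbol\omega}f_i$ is continuously differentiable, convex and $L$-smooth; and $\sigma_*^2=\mathbb{E}_{\boldsymbol\omega}\|\nabla f_{\boldsymbol\omega}(X_* )\|^2<\infty$. Let $0<h<\min\{\frac{1}{2R\gamma},\frac{1}{2R\sqrt L}\}$ and let $(x_i,v_i)_{i\in\mathbb{N}}$ be the iterates of the stochastic gradient Polyak Heavy Ball scheme with stepsize $h$, friction $\gamma$ and initialisation $(x_0,v_0)\in\mathbb{R}^{2d}$. Set $\gamma_h=\frac{1-e^{-\gamma h}}{h e^{-\gamma h}}$ and $$c=\frac{\min\{\gamma,\ \mu\gamma/\gamma_h^2\}}{4}-C(\mu,L,\gamma)hR,$$ where $C(\mu,L,\gamma)$ is a constant depending on $\mu$, $L$ and $\gamma$. Then for $k\in\mathbb{N}$: (i) if the stochastic gradients are generated by Random Reshuffling, $$\mathbb{E}[F(x_{2kR})-F(X_* )]\le \mathbb{E}\,\mathcal{V}(x_{2kR},v_{2kR})\le (1-chR)^k\,\mathcal{V}(x_0,v_0)+\frac{C(\mu,L,\gamma)h^3R^2\sigma_*^2}{c};$$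 (ii) if the stochastic gradients are generated by the Symmetric Minibatching Strategy, $$\mathbb{E}[F(x_{2kR})-F(X_* )]\le \mathbb{E}\,\mathcal{V}(x_{2kR},v_{2kR})\le (1-chR)^k\,\mathcal{V}(x_0,v_0)+\frac{C(\mu,L,\gamma)h^4R^3\sigma_*^2}{c}.$$
   Context: A continuously differentiable $g:\mathbb{R}^d\to\mathbb{R}$ is $L$-smooth if $\|\nabla g(x)-\nabla g(y)\|\le L\|x-y\|$ for all $x,y$; it is $\mu$-strongly convex if $g(x)\ge g(y)+\langle\nabla g(y),x-y\rangle+\frac{\mu}{2}\|x-y\|^2$ for all $x,y$, and convex if this holds with $\mu=0$. $\|\cdot\|$ is the Euclidean norm. Stochastic gradient Polyak Heavy Ball scheme: given batches $\boldsymbol\omega_0,\boldsymbol\omega_1,\dots$ (random subsets of $\{1,\dots,N\}$ of size $n$), for $k\ge0$ $$x_{k+1}=x_k+he^{-\gamma h}v_k-h^2\nabla f_{\boldsymbol\omega_k}(x_k),\qquad v_{k+1}=e^{-\gamma h}v_k-h\nabla f_{\boldsymbol\omega_k}(x_k).$$ An epoch consists of $R=N/n$ consecutive iterations ($n$ divides $N$). Random Reshuffling (RR): for each epoch, independently of the past, draw a uniformly random ordered partition of $\{1,\dots,N\}$ into $R$ batches of size $n$ (sampling indices without replacement) and use these batches in order over the $R$ iterations of the epoch. Symmetric Minibatching Strategy (SMS): epochs are grouped in consecutive pairs. For each pair, independently of the past, draw a uniformly random ordered partition of $\{1,\dots,N\}$ into $R$ batches of size $n$; use these batches in order in the first epoch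 of the pair and in reversed order in the second epoch. Thus in the first pair $\boldsymbol\omega_{R+i}=\boldsymbol\omega_{R-1-i}$ for $0\le i\le R-1$. In $\sigma_*^2=\mathbb{E}_{\boldsymbol\omega}\|\nabla f_{\boldsymbol\omega}(X_* )\|^2$, $\boldsymbol\omega$ is a uniformly random size-$n$ subset of $\{1,\dots,N\}$. Lyapunov function: $$\mathcal{V}(x,v)=F(x)-F(X_* )+\frac{\gamma_h^2}{4}\|x-X_*\|^2+\frac{\gamma_h}{2}\langle x-X_*,v\rangle+\frac12\|v\|^2.$$ Expectations are over the random batches.
   Formalization: The formal theorem additionally assumes c > 0: for c = 0 the error term divides by zero, and for c < 0 with σ_*² > 0 the bound already fails at k = 0. *)

theory Defs
  imports "HOL-Probability.Probability"
begin

text \<open>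
  The constant of the theorem must not depend on the dimension, so the dimension has to be
  quantified inside the statement and cannot be a type. All spaces \<open>\<real>\<^sup>d\<close> are therefore
  realised inside one type, the finitely supported real sequences with the Euclidean inner product;
  \<open>\<real>\<^sup>d\<close> is the subspace of the sequences that vanish from index \<open>d\<close> on.
  (The type of finitely supported functions in HOL-Library cannot be used, as HOL-Analysis equips it
  with the \<open>\<ell>\<^sup>1\<close> metric.)
\<close>

typedef fseq = "{x :: nat \<Rightarrow> real. finite {i. x i \<noteq> 0}}"
  morphisms coord Abs_fseq
  by (rule exI[of _ "\<lambda>_. 0"]) simp

lemma finite_coord: "finite {i. coord x i \<noteq> 0}"
  using coord[of x] by simp

lemma fseq_eqI: "(\<And>i. coord x i = coord y i) \<Longrightarrow> x = y"
  by (simp add: coord_inject[symmetric] fun_eq_iff)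

instantiation fseq :: real_inner
begin

definition "0 = Abs_fseq (\<lambda>_. 0)"
definition "x + y = Abs_fseq (\<lambda>i. coord x i + coord y i)"
definition "- x = Abs_fseq (\<lambda>i. - coord x i)"
definition "x - y = Abs_fseq (\<lambda>i. coord x i - coord y i)"
definition "r *\<^sub>R x = Abs_fseq (\<lambda>i. r * coord x i)"
definition "inner x y = (\<Sum>i | coord x i \<noteq> 0 \<and> coord y i \<noteq> 0. coord x i * coord y i)"
definition "norm (x :: fseq) = sqrt (inner x x)"
definition "sgn (x :: fseq) = inverse (norm x) *\<^sub>R x"
definition "dist (x :: fseq) y = norm (x - y)"
definition "(uniformity :: (fseq \<times> fseq) filter) =
  (INF e\<in>{0 <..}. principal {(x, y). dist x y < e})"
definition "open (U :: fseq set) \<longleftrightarrow>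
  (\<forall>x\<in>U. eventually (\<lambda>(x', y). x' = x \<longrightarrow> y \<in> U) uniformity)"

lemma coord_zero [simp]: "coord 0 i = 0"
  by (simp add: zero_fseq_def Abs_fseq_inverse)

lemma coord_add [simp]: "coord (x + y) i = coord x i + coord y i"
proof -
  have "finite {i. coord x i + coord y i \<noteq> 0}"
    by (rule finite_subset[OF _ finite_UnI[OF finite_coord[of x] finite_coord[of y]]]) auto
  then show ?thesis by (simp add: plus_fseq_def Abs_fseq_inverse)
qed

lemma coord_uminus [simp]: "coord (- x) i = - coord x i"
  by (simp add: uminus_fseq_def Abs_fseq_inverse finite_coord)

lemma coord_diff [simp]: "coord (x - y) i = coord x i - coord y i"
proof -
  have "finite {i. coord x i - coord y i \<noteq> 0}"
    by (rule finite_subset[OF _ finite_UnI[OF finite_coord[of x] finite_coord[of y]]]) auto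
  then show ?thesis by (simp add: minus_fseq_def Abs_fseq_inverse)
qed

lemma coord_scaleR [simp]: "coord (r *\<^sub>R x) i = r * coord x i"
proof -
  have "finite {i. r * coord x i \<noteq> 0}"
    by (rule finite_subset[OF _ finite_coord[of x]]) auto
  then show ?thesis by (simp add: scaleR_fseq_def Abs_fseq_inverse)
qed

lemma inner_fseq_superset:
  assumes "finite A" "{i. coord x i \<noteq> 0 \<and> coord y i \<noteq> 0} \<subseteq> A"
  shows "inner x y = (\<Sum>i\<in>A. coord x i * coord y i)"
  unfolding inner_fseq_def by (rule sum.mono_neutral_left) (use assms in auto)

instance
proof
  fix x y z :: fseq and a b r :: real
  show "x + y + z = x + (y + z)" "x + y = y + x" "0 + x = x" "- x + x = 0" "x - y = x + - y"
    by (auto intro!: fseq_eqI)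
  show "a *\<^sub>R (x + y) = a *\<^sub>R x + a *\<^sub>R y" "(a + b) *\<^sub>R x = a *\<^sub>R x + b *\<^sub>R x"
    "a *\<^sub>R b *\<^sub>R x = (a * b) *\<^sub>R x" "1 *\<^sub>R x = x"
    by (auto intro!: fseq_eqI simp: algebra_simps)
  show "inner x y = inner y x"
    by (simp add: inner_fseq_def mult.commute conj_commute)
  let ?A = "{i. coord z i \<noteq> 0}"
  have 1: "inner w z = (\<Sum>i\<in>?A. coord w i * coord z i)" for w
    by (rule inner_fseq_superset) (auto simp: finite_coord)
  show "inner (x + y) z = inner x z + inner y z"
    by (simp add: 1 sum.distrib algebra_simps)
  have 2: "inner w y = (\<Sum>i | coord y i \<noteq> 0. coord w i * coord y i)" for w
    by (rule inner_fseq_superset) (auto simp: finite_coord)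
  show "inner (r *\<^sub>R x) y = r * inner x y"
    by (simp add: 2 sum_distrib_left algebra_simps)
  show "0 \<le> inner x x"
    unfolding inner_fseq_def by (rule sum_nonneg) simp
  show "inner x x = 0 \<longleftrightarrow> x = 0"
  proof
    assume "inner x x = 0"
    then have "\<forall>i\<in>{i. coord x i \<noteq> 0}. coord x i * coord x i = 0"
      using finite_coord[of x] by (simp add: inner_fseq_def sum_nonneg_eq_0_iff)
    then show "x = 0" by (intro fseq_eqI) auto
  qed (simp add: inner_fseq_def)
qed (rule sgn_fseq_def dist_fseq_def uniformity_fseq_def norm_fseq_def open_fseq_def)+

end

definition Rd :: "nat \<Rightarrow> fseq set" where
  "Rd d = {x. \<forall>i\<ge>d. coord x i = 0}"

text \<open>
  Functions on \<open>\<real>\<^sup>d\<close> are represented by functions on the whole type, of which only the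
  values on \<open>Rd d\<close> are used: derivatives are taken within \<open>Rd d\<close>, and the gradient is
  the unique vector of \<open>Rd d\<close> representing the derivative.
\<close>

definition grad :: "nat \<Rightarrow> (fseq \<Rightarrow> real) \<Rightarrow> fseq \<Rightarrow> fseq" where
  "grad d g x = (THE G. G \<in> Rd d \<and> (g has_derivative (\<lambda>y. inner G y)) (at x within Rd d))"

definition cont_diff :: "nat \<Rightarrow> (fseq \<Rightarrow> real) \<Rightarrow> bool" where
  "cont_diff d g \<longleftrightarrow> g differentiable_on Rd d \<and> continuous_on (Rd d) (grad d g)"

definition smooth :: "nat \<Rightarrow> real \<Rightarrow> (fseq \<Rightarrow> real) \<Rightarrow> bool" where
  "smooth d L g \<longleftrightarrow>
     (\<forall>x\<in>Rd d. \<forall>y\<in>Rd d. norm (grad d g x - grad d g y) \<le> L * norm (x - y))"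

definition strongly_convex :: "nat \<Rightarrow> real \<Rightarrow> (fseq \<Rightarrow> real) \<Rightarrow> bool" where
  "strongly_convex d \<mu> g \<longleftrightarrow>
     (\<forall>x\<in>Rd d. \<forall>y\<in>Rd d. g x \<ge> g y + inner (grad d g y) (x - y) + \<mu> / 2 * (norm (x - y))\<^sup>2)"

abbreviation cvx :: "nat \<Rightarrow> (fseq \<Rightarrow> real) \<Rightarrow> bool" where
  "cvx d g \<equiv> strongly_convex d 0 g"

definition batches :: "nat \<Rightarrow> nat \<Rightarrow> nat set set" where
  "batches N n = {\<omega>. \<omega> \<subseteq> {1..N} \<and> card \<omega> = n}"

definition batch_fun :: "nat \<Rightarrow> (nat \<Rightarrow> fseq \<Rightarrow> real) \<Rightarrow> nat set \<Rightarrow> fseq \<Rightarrow> real" where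
  "batch_fun n f \<omega> x = 1 / real n * (\<Sum>i\<in>\<omega>. f i x)"

definition sigma_sq :: "nat \<Rightarrow> nat \<Rightarrow> nat \<Rightarrow> (nat \<Rightarrow> fseq \<Rightarrow> real) \<Rightarrow> fseq \<Rightarrow> real" where
  "sigma_sq d N n f Xs =
     (\<integral>\<omega>. (norm (grad d (batch_fun n f \<omega>) Xs))\<^sup>2 \<partial>uniform_count_measure (batches N n))"

text \<open>
  Heavy Ball iterates \<open>(x\<^sub>k, v\<^sub>k)\<close> driven by the batch sequence \<open>\<omega>\<close>.
\<close>

fun heavy_ball ::
  "nat \<Rightarrow> nat \<Rightarrow> (nat \<Rightarrow> fseq \<Rightarrow> real) \<Rightarrow> real \<Rightarrow> real \<Rightarrow> fseq \<Rightarrow> fseq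
     \<Rightarrow> (nat \<Rightarrow> nat set) \<Rightarrow> nat \<Rightarrow> fseq \<times> fseq" where
  "heavy_ball d n f \<gamma> h x0 v0 \<omega> 0 = (x0, v0)"
| "heavy_ball d n f \<gamma> h x0 v0 \<omega> (Suc k) =
     (let (x, v) = heavy_ball d n f \<gamma> h x0 v0 \<omega> k;
          g = grad d (batch_fun n f (\<omega> k)) x
      in (x + (h * exp (- \<gamma> * h)) *\<^sub>R v - h\<^sup>2 *\<^sub>R g, exp (- \<gamma> * h) *\<^sub>R v - h *\<^sub>R g))"

definition ordered_partitions :: "nat \<Rightarrow> nat \<Rightarrow> nat \<Rightarrow> nat set list set" where
  "ordered_partitions N n R =
     {p. length p = R \<and> distinct p \<and> (\<forall>\<omega>\<in>set p. card \<omega> = n) \<and> partition_on {1..N} (set p)}"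

text \<open>
  The probability space underlying both sampling strategies: an i.i.d. sequence of uniformly random
  ordered partitions. Random Reshuffling uses \<open>\<xi> e\<close> in epoch \<open>e\<close>; the symmetric
  strategy uses \<open>\<xi> m\<close> in the epochs \<open>2m\<close> (in order) and \<open>2m + 1\<close> (reversed).
\<close>

definition sampling :: "nat \<Rightarrow> nat \<Rightarrow> nat \<Rightarrow> (nat \<Rightarrow> nat set list) measure" where
  "sampling N n R = PiM UNIV (\<lambda>_. uniform_count_measure (ordered_partitions N n R))"

definition rr_batch :: "nat \<Rightarrow> (nat \<Rightarrow> nat set list) \<Rightarrow> nat \<Rightarrow> nat set" where
  "rr_batch R \<xi> k = \<xi> (k div R) ! (k mod R)"

definition sms_batch :: "nat \<Rightarrow> (nat \<Rightarrow> nat set list) \<Rightarrow> nat \<Rightarrow> nat set" where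
  "sms_batch R \<xi> k =
     (let p = \<xi> (k div R div 2)
      in if even (k div R) then p ! (k mod R) else rev p ! (k mod R))"

definition gamma_h :: "real \<Rightarrow> real \<Rightarrow> real" where
  "gamma_h \<gamma> h = (1 - exp (- \<gamma> * h)) / (h * exp (- \<gamma> * h))"

definition lyapunov ::
  "(fseq \<Rightarrow> real) \<Rightarrow> fseq \<Rightarrow> real \<Rightarrow> real \<Rightarrow> fseq \<times> fseq \<Rightarrow> real" where
  "lyapunov F Xs \<gamma> h = (\<lambda>(x, v). F x - F Xs + (gamma_h \<gamma> h)\<^sup>2 / 4 * (norm (x - Xs))\<^sup>2
     + gamma_h \<gamma> h / 2 * inner (x - Xs) v + 1 / 2 * (norm v)\<^sup>2)"

end

theory Submission
  imports Defs
begin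

text \<open>
  Write \<open>\<Gamma>\<close> for \<open>gamma_h \<gamma> h\<close> and \<open>T = 2 h R\<close> for the length of a pair of epochs. The momentum factor
  \<open>exp (- \<gamma> h)\<close> equals \<open>1 / (1 + h \<Gamma>)\<close>, so that up to \<open>O(T\<^sup>2)\<close> a pair of epochs is one explicit
  Euler step of size \<open>T\<close> for the damped flow \<open>x' = v\<close>, \<open>v' = - \<Gamma> v - \<nabla>F(x)\<close>. Along this flow all
  indefinite terms in the derivative of the Lyapunov function \<open>\<V>\<close> cancel, and what is left is at most
  \<open>- m \<V> / 2\<close> with \<open>m = min \<gamma> (\<mu> \<gamma> / \<Gamma>\<^sup>2)\<close> (\<open>energy_deriv_euler\<close>, \<open>lyapunov_decay\<close>). The theorem
  asks only for a quarter of this rate, lowered further by \<open>C h R\<close>. Hence errors \<open>O(T\<^sup>2) \<V>\<close> and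
  \<open>\<epsilon> T \<V>\<close> can be absorbed; and \<open>c > 0\<close> with a large \<open>C\<close> forces \<open>h R\<close> to be as small as desired.

  The rest is the noise. Let \<open>G\<^sub>i\<close> be the batch gradients at the minimiser and \<open>P\<^sub>k\<close> their partial sums,
  which vanish at the end of each epoch. The part of \<open>(x, v)\<close> that responds linearly to the \<open>G\<^sub>i\<close>
  is split off (\<open>position_noise\<close>, \<open>momentum_noise\<close>). Everything else can be bounded without
  probability, by summation by parts, in terms of \<open>q = h\<^sup>2 \<Sum>\<^sub>k \<parallel>P\<^sub>k\<parallel>\<close>: the noise moves the points at which
  gradients are taken by \<open>O(q)\<close>, hence the end of the pair by \<open>O(T q)\<close>, and Young's inequality turns
  its product with \<open>\<surd>\<V>\<close> into \<open>\<epsilon> T \<V> + O(T q\<^sup>2)\<close> (\<open>energy_drift\<close>, \<open>run_drift\<close>).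
  Batches drawn without replacement are negatively correlated, so that \<open>E \<parallel>P\<^sub>k\<parallel>\<^sup>2 \<le> k \<sigma>\<^sub>*\<^sup>2\<close> and
  \<open>E q\<^sup>2 \<le> 4 h\<^sup>4 R\<^sup>3 \<sigma>\<^sub>*\<^sup>2\<close> (\<open>sum_norm_partial_sum_le\<close>).

  The two strategies differ in the linear response, which has size \<open>O(q)\<close> in general. For Random
  Reshuffling it has mean zero and therefore contributes only its square \<open>O(q\<^sup>2)\<close>, of order
  \<open>h\<^sup>4 R\<^sup>3 \<sigma>\<^sub>*\<^sup>2\<close>. For the symmetric strategy \<open>\<Sum>\<^sub>k P\<^sub>k = 0\<close>; then its leading part cancels, it is
  \<open>O(T q)\<close> like the nonlinear error, and the total is \<open>O(T q\<^sup>2)\<close>, of order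
  \<open>h\<^sup>5 R\<^sup>4 \<sigma>\<^sub>*\<^sup>2\<close>. Dividing the error of one pair by its contraction \<open>c h R\<close> gives the two bounds
  (\<open>average_contraction\<close>, \<open>lyapunov_bounds\<close>).
\<close>

section \<open>The Heavy Ball path as a perturbed Euler step\<close>

lemma norm_contractive_recursion_le:
  fixes a b :: "nat \<Rightarrow> 'a::real_normed_vector"
  assumes "a 0 = 0" and rec: "\<And>k. k < m \<Longrightarrow> a (Suc k) = \<eta> *\<^sub>R a k + b k"
    and "0 \<le> \<eta>" "\<eta> \<le> 1" and "k \<le> m"
  shows "norm (a k) \<le> (\<Sum>i<k. norm (b i))"
  using \<open>k \<le> m\<close>
proof (induction k)
  case 0 then show ?case using assms by simp
next
  case (Suc k)
  have "norm (a (Suc k)) \<le> \<eta> * norm (a k) + norm (b k)"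
    using rec[of k] Suc.prems norm_triangle_ineq[of "\<eta> *\<^sub>R a k" "b k"] assms(3) by simp
  also have "\<eta> * norm (a k) \<le> norm (a k)"
    using assms(3,4) by (simp add: mult_left_le_one_le)
  finally show ?case using Suc by simp
qed

text \<open>
  The response of the scheme to the batch gradients \<open>G\<close> at the minimiser, started from rest at \<open>0\<close>. Both parts
  carry the opposite sign of the iterates, so that adding them to \<open>v\<close> and \<open>x\<close> removes the noise.
\<close>
primrec momentum_noise :: "real \<Rightarrow> real \<Rightarrow> (nat \<Rightarrow> 'a::real_vector) \<Rightarrow> nat \<Rightarrow> 'a" where
  "momentum_noise \<eta> h G 0 = 0"
| "momentum_noise \<eta> h G (Suc k) = \<eta> *\<^sub>R momentum_noise \<eta> h G k + h *\<^sub>R G k"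

primrec position_noise :: "real \<Rightarrow> real \<Rightarrow> (nat \<Rightarrow> 'a::real_vector) \<Rightarrow> nat \<Rightarrow> 'a" where
  "position_noise \<eta> h G 0 = 0"
| "position_noise \<eta> h G (Suc k) = position_noise \<eta> h G k + h *\<^sub>R momentum_noise \<eta> h G (Suc k)"

lemma sum_momentum_noise:
  "(\<Sum>t\<in>S. momentum_noise \<eta> h (G t) k) = momentum_noise \<eta> h (\<lambda>i. \<Sum>t\<in>S. G t i) k"
  by (induction k) (simp_all add: sum.distrib flip: scaleR_right.sum)

lemma sum_position_noise:
  "(\<Sum>t\<in>S. position_noise \<eta> h (G t) k) = position_noise \<eta> h (\<lambda>i. \<Sum>t\<in>S. G t i) k"
  by (induction k)
     (simp_all add: sum.distrib sum_momentum_noise del: momentum_noise.simps flip: scaleR_right.sum)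

lemma momentum_noise_eq_0:
  "(\<And>i. i < k \<Longrightarrow> G i = 0) \<Longrightarrow> momentum_noise \<eta> h G k = 0"
  by (induction k) simp_all

lemma position_noise_eq_0:
  "(\<And>i. i < k \<Longrightarrow> G i = 0) \<Longrightarrow> position_noise \<eta> h G k = 0"
  by (induction k) (simp_all add: momentum_noise_eq_0)

text \<open>
  A Heavy Ball path of \<open>m\<close> steps whose stochastic gradient at step \<open>k\<close> is \<open>G k + r k\<close>. Here \<open>G k\<close> is its
  value at the minimiser, \<open>r0 k\<close> is what \<open>r k\<close> would be if the gradient were taken at \<open>x 0\<close>,
  \<open>p\<close> stands for \<open>x 0\<close> minus the minimiser, and \<open>g\<close> for the full gradient at \<open>x 0\<close>. The form
  \<open>\<eta> (1 + h \<Gamma>) = 1\<close> of the momentum factor makes \<open>\<Gamma>\<close> the friction of the limiting flow.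
\<close>
locale perturbed_path =
  fixes x v G r r0 :: "nat \<Rightarrow> 'a::real_inner" and p g :: 'a
    and h \<Gamma> \<eta> L :: real and m :: nat
  assumes h_pos: "h > 0" and \<Gamma>_nonneg: "\<Gamma> \<ge> 0" and L_nonneg: "L \<ge> 0"
    and \<eta>_eq: "\<eta> * (1 + h * \<Gamma>) = 1"
    and x_Suc: "k < m \<Longrightarrow> x (Suc k) = x k + h *\<^sub>R v (Suc k)"
    and v_Suc: "k < m \<Longrightarrow> v (Suc k) = \<eta> *\<^sub>R v k - h *\<^sub>R (G k + r k)"
    and norm_r: "k < m \<Longrightarrow> norm (r k) \<le> L * (norm p + norm (x k - x 0))"
    and norm_r_diff: "k < m \<Longrightarrow> norm (r k - r0 k) \<le> L * norm (x k - x 0)"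
    and sum_r0: "(\<Sum>k<m. r0 k) = real m *\<^sub>R g"
    and sum_G: "(\<Sum>k<m. G k) = 0"
begin

definition T :: real where "T = h * real m"
definition P :: "nat \<Rightarrow> 'a" where "P k = (\<Sum>i<k. G i)"
definition q :: real where "q = h\<^sup>2 * (\<Sum>k<m. norm (P k))"

abbreviation noise_v where "noise_v \<equiv> momentum_noise \<eta> h G"
abbreviation noise_x where "noise_x \<equiv> position_noise \<eta> h G"

lemma \<eta>_pos: "\<eta> > 0"
proof -
  have "1 + h * \<Gamma> > 0" using h_pos \<Gamma>_nonneg by (simp add: add_pos_nonneg)
  then show ?thesis using \<eta>_eq by (metis zero_less_mult_pos2 zero_less_one)
qed

lemma one_minus_\<eta>: "0 \<le> 1 - \<eta>" "1 - \<eta> \<le> h * \<Gamma>"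
proof -
  have e: "1 - \<eta> = \<eta> * (h * \<Gamma>)" using \<eta>_eq by (simp add: algebra_simps)
  have nn: "0 \<le> h * \<Gamma>" using h_pos \<Gamma>_nonneg by simp
  show a: "0 \<le> 1 - \<eta>" using e nn \<eta>_pos by simp
  have "\<eta> * (h * \<Gamma>) \<le> 1 * (h * \<Gamma>)" by (rule mult_right_mono) (use a nn in auto)
  then show "1 - \<eta> \<le> h * \<Gamma>" using e by simp
qed

lemma T_nonneg: "T \<ge> 0" using h_pos by (simp add: T_def)
lemma q_nonneg: "q \<ge> 0" by (simp add: q_def sum_nonneg)
lemma P_0 [simp]: "P 0 = 0" by (simp add: P_def)
lemma P_m [simp]: "P m = 0" by (simp add: P_def sum_G)

text \<open>
  Bernoulli's inequality from both sides, for \<open>\<eta>\<^sup>m\<close> and for \<open>(1 + h \<Gamma>)\<^sup>m = 1 / \<eta>\<^sup>m\<close>: the momentum kept after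
  time \<open>T\<close> is \<open>1 - T \<Gamma>\<close> up to a second order error.
\<close>
lemma power_\<eta>_bounds:
  "0 \<le> 1 - \<eta> ^ m" "1 - \<eta> ^ m \<le> T * \<Gamma>" "\<bar>\<eta> ^ m - 1 + T * \<Gamma>\<bar> \<le> (T * \<Gamma>)\<^sup>2"
proof -
  let ?s = "h * \<Gamma>"
  have s: "?s \<ge> 0" using h_pos \<Gamma>_nonneg by simp
  have ms: "T * \<Gamma> = real m * ?s" by (simp add: T_def)
  have nn: "T * \<Gamma> \<ge> 0" using T_nonneg \<Gamma>_nonneg by simp
  show "0 \<le> 1 - \<eta> ^ m" using \<eta>_pos one_minus_\<eta>(1) by (simp add: power_le_one)
  have "1 + real m * (\<eta> - 1) \<le> (1 + (\<eta> - 1)) ^ m"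
    by (rule Bernoulli_inequality) (use \<eta>_pos in auto)
  moreover have "real m * (1 - \<eta>) \<le> T * \<Gamma>"
    using mult_left_mono[OF one_minus_\<eta>(2), of "real m"] by (simp add: ms)
  ultimately show up: "1 - \<eta> ^ m \<le> T * \<Gamma>" by (simp add: algebra_simps)
  have "1 + T * \<Gamma> \<le> (1 + ?s) ^ m"
    unfolding ms by (rule Bernoulli_inequality) (use s in auto)
  then have "\<eta> ^ m * (1 + T * \<Gamma>) \<le> \<eta> ^ m * (1 + ?s) ^ m"
    using \<eta>_pos by (intro mult_left_mono) auto
  also have "\<dots> = 1" using \<eta>_eq by (simp add: power_mult_distrib[symmetric])
  finally have a: "\<eta> ^ m * (1 + T * \<Gamma>) \<le> 1" .
  have "\<eta> ^ m \<le> 1 - \<eta> ^ m * (T * \<Gamma>)" using a by (simp add: algebra_simps)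
  moreover have "(1 - T * \<Gamma>) * (T * \<Gamma>) \<le> \<eta> ^ m * (T * \<Gamma>)"
    by (rule mult_right_mono) (use up nn in auto)
  ultimately have "\<eta> ^ m - 1 + T * \<Gamma> \<le> (T * \<Gamma>)\<^sup>2" by (simp add: algebra_simps power2_eq_square)
  then show "\<bar>\<eta> ^ m - 1 + T * \<Gamma>\<bar> \<le> (T * \<Gamma>)\<^sup>2" using up by simp
qed

lemma power_\<eta>_bounds_le:
  assumes "k \<le> m" shows "0 \<le> 1 - \<eta> ^ k" "1 - \<eta> ^ k \<le> T * \<Gamma>"
proof -
  have "\<eta> ^ m \<le> \<eta> ^ k"
    using assms \<eta>_pos one_minus_\<eta>(1) by (intro power_decreasing) auto
  then show "1 - \<eta> ^ k \<le> T * \<Gamma>" using power_\<eta>_bounds(2) by linarith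
  show "0 \<le> 1 - \<eta> ^ k" using \<eta>_pos one_minus_\<eta>(1) by (simp add: power_le_one)
qed

text \<open>
  Without damping, the momentum noise would be \<open>h P k\<close>. The lag is the correction due to \<open>\<eta> < 1\<close>; it is driven by
  the partial sums \<open>P k\<close> with the small factor \<open>1 - \<eta> \<le> h \<Gamma>\<close>, which is summation by parts in recursive form.
\<close>
definition lag :: "nat \<Rightarrow> 'a" where "lag k = P k - (1 / h) *\<^sub>R noise_v k"

lemma lag_0 [simp]: "lag 0 = 0" by (simp add: lag_def)

lemma noise_v_eq: "noise_v k = h *\<^sub>R (P k - lag k)"
  using h_pos by (simp add: lag_def)

lemma lag_Suc: "lag (Suc k) = \<eta> *\<^sub>R lag k + (1 - \<eta>) *\<^sub>R P k"
  using h_pos by (simp add: lag_def P_def algebra_simps)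

lemma norm_lag:
  assumes "k \<le> m" shows "norm (lag k) \<le> h * \<Gamma> * (\<Sum>k<m. norm (P k))"
proof -
  have "norm (lag k) \<le> (\<Sum>i<k. norm ((1 - \<eta>) *\<^sub>R P i))"
    by (rule norm_contractive_recursion_le[where m = m and \<eta> = \<eta>])
       (use \<eta>_pos one_minus_\<eta> assms lag_Suc in \<open>auto simp: lag_def\<close>)
  also have "\<dots> = (1 - \<eta>) * (\<Sum>i<k. norm (P i))"
    using one_minus_\<eta>(1) by (simp add: sum_distrib_left)
  also have "\<dots> \<le> h * \<Gamma> * (\<Sum>i<m. norm (P i))"
    using one_minus_\<eta> assms by (intro mult_mono sum_mono2 sum_nonneg) auto
  finally show ?thesis .
qed

lemma noise_x_eq:
  "noise_x k = h\<^sup>2 *\<^sub>R ((\<Sum>j<k. P (Suc j)) - (\<Sum>j<k. lag (Suc j)))"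
  by (induction k) (simp_all add: noise_v_eq algebra_simps power2_eq_square del: momentum_noise.simps)

lemma norm_sum_lag:
  assumes "k \<le> m" shows "h\<^sup>2 * norm (\<Sum>j<k. lag (Suc j)) \<le> T * \<Gamma> * q"
proof -
  have "norm (\<Sum>j<k. lag (Suc j)) \<le> (\<Sum>j<k. h * \<Gamma> * (\<Sum>k<m. norm (P k)))"
    by (rule order_trans[OF norm_sum]) (rule sum_mono, rule norm_lag, use assms in simp)
  also have "\<dots> \<le> real m * (h * \<Gamma> * (\<Sum>k<m. norm (P k)))"
    using assms h_pos \<Gamma>_nonneg by (simp add: mult_right_mono sum_nonneg)
  finally have "h\<^sup>2 * norm (\<Sum>j<k. lag (Suc j)) \<le> h\<^sup>2 * (real m * (h * \<Gamma> * (\<Sum>k<m. norm (P k))))"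
    by (rule mult_left_mono) simp
  then show ?thesis by (simp add: T_def q_def algebra_simps)
qed

lemma norm_noise_x:
  assumes "k \<le> m" "T * \<Gamma> \<le> 1" shows "norm (noise_x k) \<le> 2 * q"
proof -
  have "norm (\<Sum>j<k. P (Suc j)) \<le> (\<Sum>j<k. norm (P (Suc j)))" by (rule norm_sum)
  also have "\<dots> \<le> (\<Sum>j<m. norm (P (Suc j)))"
    using assms by (intro sum_mono2) auto
  also have "\<dots> = (\<Sum>j<m. norm (P j))"
    using sum.lessThan_Suc_shift[of "\<lambda>j. norm (P j)" m] by simp
  finally have "h\<^sup>2 * norm (\<Sum>j<k. P (Suc j)) \<le> q" unfolding q_def by (rule mult_left_mono) simp
  moreover have "h\<^sup>2 * norm (\<Sum>j<k. lag (Suc j)) \<le> 1 * q"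
    using norm_sum_lag[OF assms(1)] mult_right_mono[OF assms(2) q_nonneg] by linarith
  moreover have "norm (noise_x k) \<le> h\<^sup>2 * (norm (\<Sum>j<k. P (Suc j)) + norm (\<Sum>j<k. lag (Suc j)))"
    unfolding noise_x_eq norm_scaleR by (simp add: mult_left_mono norm_triangle_ineq4)
  ultimately show ?thesis by (simp add: algebra_simps)
qed

text \<open>
  At the end of the path \<open>P m = 0\<close>, so that only the lag remains of the momentum noise.
\<close>
lemma norm_noise_v_final: "norm (noise_v m) \<le> \<Gamma> * q"
proof -
  have "norm (noise_v m) = h * norm (lag m)" using h_pos by (simp add: noise_v_eq)
  also have "\<dots> \<le> h * (h * \<Gamma> * (\<Sum>k<m. norm (P k)))"
    using norm_lag[of m] h_pos by (intro mult_left_mono) auto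
  finally show ?thesis by (simp add: q_def power2_eq_square algebra_simps)
qed

text \<open>
  If the partial sums themselves add up to \<open>0\<close>, both parts of the noise gain a factor \<open>T\<close>. The leading
  part of the position noise is \<open>h\<^sup>2 \<Sum>\<^sub>k P k\<close>, and that of the momentum noise is \<open>- h (1 - \<eta>) \<Sum>\<^sub>k P k\<close>.
\<close>
lemma balanced_noise_final:
  assumes bal: "(\<Sum>k<m. P k) = 0"
  shows "norm (noise_x m) \<le> T * \<Gamma> * q" "norm (noise_v m) \<le> T * \<Gamma>\<^sup>2 * q"
proof -
  have "(\<Sum>j<m. P (Suc j)) = 0"
    using sum.lessThan_Suc_shift[of P m] bal by simp
  then show "norm (noise_x m) \<le> T * \<Gamma> * q"
    unfolding noise_x_eq norm_scaleR using norm_sum_lag[of m] by simp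
  \<comment> \<open>The lag is compared with its undamped version, the sum of the \<open>P i\<close>, which ends at \<open>0\<close>.\<close>
  define w where "w k = lag k - (1 - \<eta>) *\<^sub>R (\<Sum>i<k. P i)" for k
  have "norm (w m) \<le> (\<Sum>i<m. norm (- (1 - \<eta>) *\<^sub>R lag i))"
    by (rule norm_contractive_recursion_le[where m = m and \<eta> = 1])
       (auto simp: w_def lag_Suc algebra_simps)
  also have "\<dots> \<le> (\<Sum>i<m. (h * \<Gamma>) * (h * \<Gamma> * (\<Sum>k<m. norm (P k))))"
    using one_minus_\<eta> norm_lag h_pos \<Gamma>_nonneg
    by (intro sum_mono) (auto intro!: mult_mono sum_nonneg)
  finally have "norm (lag m) \<le> real m * ((h * \<Gamma>) * (h * \<Gamma> * (\<Sum>k<m. norm (P k))))"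
    by (simp add: w_def bal)
  then have "h * norm (lag m) \<le> h * (real m * ((h * \<Gamma>) * (h * \<Gamma> * (\<Sum>k<m. norm (P k)))))"
    using h_pos by (intro mult_left_mono) auto
  moreover have "norm (noise_v m) = h * norm (lag m)" using h_pos by (simp add: noise_v_eq)
  ultimately show "norm (noise_v m) \<le> T * \<Gamma>\<^sup>2 * q"
    by (simp add: q_def T_def power2_eq_square algebra_simps)
qed

text \<open>
  The momentum with both its noise and its freely decaying initial value removed: what the gradient increments
  \<open>r k\<close> have built up.
\<close>
definition drive :: "nat \<Rightarrow> 'a" where "drive k = v k + noise_v k - \<eta> ^ k *\<^sub>R v 0"

lemma drive_Suc: "k < m \<Longrightarrow> drive (Suc k) = \<eta> *\<^sub>R drive k + (- h) *\<^sub>R r k"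
  by (simp add: drive_def v_Suc algebra_simps)

lemma drive_0 [simp]: "drive 0 = 0" by (simp add: drive_def)

lemma norm_drive:
  assumes "k \<le> m" and "\<And>j. j < m \<Longrightarrow> norm (x j - x 0) \<le> D"
  shows "norm (drive k) \<le> T * (L * (norm p + D))"
proof -
  have "norm (drive k) \<le> (\<Sum>i<k. norm ((- h) *\<^sub>R r i))"
    by (rule norm_contractive_recursion_le[where m = m and \<eta> = \<eta>])
       (use \<eta>_pos one_minus_\<eta> assms drive_Suc in auto)
  also have "\<dots> \<le> (\<Sum>i<m. norm ((- h) *\<^sub>R r i))" using assms by (intro sum_mono2) auto
  also have "\<dots> \<le> (\<Sum>i<m. h * (L * (norm p + D)))"
  proof (rule sum_mono)
    fix i assume i: "i \<in> {..<m}"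
    have "norm (r i) \<le> L * (norm p + norm (x i - x 0))" using norm_r i by simp
    also have "\<dots> \<le> L * (norm p + D)" using assms(2)[of i] i L_nonneg by (intro mult_left_mono) auto
    finally show "norm ((- h) *\<^sub>R r i) \<le> h * (L * (norm p + D))" using h_pos by simp
  qed
  finally show ?thesis by (simp add: T_def algebra_simps)
qed

lemma x_plus_noise_x_Suc:
  "k < m \<Longrightarrow> x (Suc k) + noise_x (Suc k) = x k + noise_x k + h *\<^sub>R (\<eta> ^ Suc k *\<^sub>R v 0 + drive (Suc k))"
  by (simp add: x_Suc drive_def algebra_simps del: momentum_noise.simps)

text \<open>
  A Gronwall argument on the maximal displacement \<open>D\<close>: the displacement feeds back into itself only through the gradients,
  with a factor \<open>T\<^sup>2 L \<le> 1/2\<close>.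
\<close>
lemma norm_x_diff:
  assumes "T * \<Gamma> \<le> 1" "2 * (T\<^sup>2 * L) \<le> 1" "k \<le> m"
  shows "norm (x k - x 0) \<le> 2 * T * norm (v 0) + 2 * T\<^sup>2 * L * norm p + 4 * q"
proof -
  define D where "D = Max ((\<lambda>j. norm (x j - x 0)) ` {..m})"
  have D: "norm (x j - x 0) \<le> D" if "j \<le> m" for j
    unfolding D_def using that by (intro Max_ge) auto
  have "norm (x j - x 0) \<le> T * norm (v 0) + T * (T * (L * (norm p + D))) + 2 * q" if "j \<le> m" for j
  proof -
    have "norm (x j + noise_x j - x 0) \<le> (\<Sum>i<j. norm (h *\<^sub>R (\<eta> ^ Suc i *\<^sub>R v 0 + drive (Suc i))))"
      using that
      by (intro norm_contractive_recursion_le[where m = m and \<eta> = 1])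
         (auto simp: x_plus_noise_x_Suc simp del: position_noise.simps(2))
    also have "\<dots> \<le> (\<Sum>i<m. norm (h *\<^sub>R (\<eta> ^ Suc i *\<^sub>R v 0 + drive (Suc i))))"
      using that by (intro sum_mono2) auto
    also have "\<dots> \<le> (\<Sum>i<m. h * (norm (v 0) + T * (L * (norm p + D))))"
    proof (rule sum_mono)
      fix i assume i: "i \<in> {..<m}"
      have "norm (\<eta> ^ Suc i *\<^sub>R v 0) \<le> norm (v 0)"
        using \<eta>_pos one_minus_\<eta>(1) power_le_one[of \<eta> "Suc i"]
        by (simp add: mult_left_le_one_le del: power_Suc)
      moreover have "norm (drive (Suc i)) \<le> T * (L * (norm p + D))"
        by (rule norm_drive) (use D i in auto)
      ultimately have "norm (\<eta> ^ Suc i *\<^sub>R v 0 + drive (Suc i)) \<le> norm (v 0) + T * (L * (norm p + D))"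
        by (intro norm_triangle_mono)
      then show "norm (h *\<^sub>R (\<eta> ^ Suc i *\<^sub>R v 0 + drive (Suc i))) \<le> h * (norm (v 0) + T * (L * (norm p + D)))"
        using h_pos by simp
    qed
    also have "\<dots> = T * norm (v 0) + T * (T * (L * (norm p + D)))"
      by (simp add: T_def algebra_simps)
    finally have "norm (x j + noise_x j - x 0) \<le> \<dots>" .
    moreover have "norm (x j - x 0) \<le> norm (x j + noise_x j - x 0) + norm (noise_x j)"
      using norm_triangle_ineq4[of "x j + noise_x j - x 0" "noise_x j"] by simp
    ultimately show ?thesis using norm_noise_x[OF that assms(1)] by linarith
  qed
  then have "D \<le> T * norm (v 0) + T * (T * (L * (norm p + D))) + 2 * q"
    unfolding D_def by (subst Max_le_iff) auto
  moreover have "D \<ge> 0" using D[of 0] by simp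
  then have "2 * (T\<^sup>2 * L) * D \<le> D" using mult_right_mono[OF assms(2)] by fastforce
  moreover have "T * (T * (L * (norm p + D))) = T\<^sup>2 * L * norm p + T\<^sup>2 * L * D"
    by (simp add: power2_eq_square algebra_simps)
  ultimately have "D \<le> 2 * T * norm (v 0) + 2 * T\<^sup>2 * L * norm p + 4 * q" by (simp add: algebra_simps)
  then show ?thesis using D[OF assms(3)] by linarith
qed

text \<open>
  The three terms are the second order error of the free decay of the momentum, the damping of the momentum that the
  gradients build up during the path, and the change of the gradients caused by the displacement \<open>D\<close>.
\<close>
lemma euler_error_v:
  assumes D: "\<And>j. j < m \<Longrightarrow> norm (x j - x 0) \<le> D"
  shows "norm (v m + noise_v m - v 0 + T *\<^sub>R (\<Gamma> *\<^sub>R v 0 + g))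
     \<le> (T * \<Gamma>)\<^sup>2 * norm (v 0) + T * \<Gamma> * (T * (L * (norm p + D))) + T * (L * D)"
proof -
  \<comment> \<open>The drive is compared with undamped accumulation of the gradients at \<open>x 0\<close>; the difference obeys a recursion with factor \<open>1\<close>.\<close>
  define b where "b k = drive k + h *\<^sub>R (\<Sum>i<k. r0 i)" for k
  have "norm (b m) \<le> (\<Sum>i<m. norm (- (1 - \<eta>) *\<^sub>R drive i - h *\<^sub>R (r i - r0 i)))"
    by (rule norm_contractive_recursion_le[where m = m and \<eta> = 1])
       (auto simp: b_def drive_Suc algebra_simps)
  also have "\<dots> \<le> (\<Sum>i<m. h * \<Gamma> * (T * (L * (norm p + D))) + h * (L * D))"
  proof (rule sum_mono)
    fix i assume i: "i \<in> {..<m}"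
    have "norm (- (1 - \<eta>) *\<^sub>R drive i) \<le> h * \<Gamma> * (T * (L * (norm p + D)))"
      unfolding norm_scaleR using one_minus_\<eta> norm_drive[OF _ D, of i] i h_pos \<Gamma>_nonneg
      by (intro mult_mono) auto
    moreover have "norm (h *\<^sub>R (r i - r0 i)) \<le> h * (L * D)"
      using norm_r_diff[of i] i mult_left_mono[OF D[of i] L_nonneg] h_pos by simp
    ultimately show "norm (- (1 - \<eta>) *\<^sub>R drive i - h *\<^sub>R (r i - r0 i))
        \<le> h * \<Gamma> * (T * (L * (norm p + D))) + h * (L * D)"
      by (meson add_mono norm_triangle_ineq4 order_trans)
  qed
  also have "\<dots> = T * \<Gamma> * (T * (L * (norm p + D))) + T * (L * D)"
    by (simp add: T_def algebra_simps)
  finally have bm: "norm (b m) \<le> \<dots>" .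
  have "v m + noise_v m - v 0 + T *\<^sub>R (\<Gamma> *\<^sub>R v 0 + g) = (\<eta> ^ m - 1 + T * \<Gamma>) *\<^sub>R v 0 + b m"
    by (simp add: b_def drive_def sum_r0 T_def algebra_simps)
  moreover have "norm ((\<eta> ^ m - 1 + T * \<Gamma>) *\<^sub>R v 0) \<le> (T * \<Gamma>)\<^sup>2 * norm (v 0)"
    unfolding norm_scaleR using power_\<eta>_bounds(3) by (rule mult_right_mono) simp
  ultimately show ?thesis using bm norm_triangle_ineq[of "(\<eta> ^ m - 1 + T * \<Gamma>) *\<^sub>R v 0" "b m"] by simp
qed

lemma euler_error_x:
  assumes D: "\<And>j. j < m \<Longrightarrow> norm (x j - x 0) \<le> D"
  shows "norm (x m + noise_x m - x 0 - T *\<^sub>R v 0)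
     \<le> T * (T * \<Gamma> * norm (v 0) + T * (L * (norm p + D)))"
proof -
  define b where "b k = x k + noise_x k - x 0 - (h * real k) *\<^sub>R v 0" for k
  have "norm (b m) \<le> (\<Sum>i<m. norm (h *\<^sub>R (- (1 - \<eta> ^ Suc i) *\<^sub>R v 0 + drive (Suc i))))"
    by (rule norm_contractive_recursion_le[where m = m and \<eta> = 1])
       (auto simp: b_def x_plus_noise_x_Suc algebra_simps simp del: position_noise.simps(2))
  also have "\<dots> \<le> (\<Sum>i<m. h * (T * \<Gamma> * norm (v 0) + T * (L * (norm p + D))))"
  proof (rule sum_mono)
    fix i assume i: "i \<in> {..<m}"
    have "norm (- (1 - \<eta> ^ Suc i) *\<^sub>R v 0) \<le> T * \<Gamma> * norm (v 0)"
      unfolding norm_scaleR using power_\<eta>_bounds_le[of "Suc i"] i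
      by (intro mult_right_mono) (auto simp del: power_Suc)
    moreover have "norm (drive (Suc i)) \<le> T * (L * (norm p + D))"
      by (rule norm_drive) (use D i in auto)
    ultimately show "norm (h *\<^sub>R (- (1 - \<eta> ^ Suc i) *\<^sub>R v 0 + drive (Suc i)))
        \<le> h * (T * \<Gamma> * norm (v 0) + T * (L * (norm p + D)))"
      unfolding norm_scaleR using h_pos by (intro mult_mono norm_triangle_mono) auto
  qed
  finally show ?thesis by (simp add: b_def T_def algebra_simps)
qed

end

context perturbed_path begin

text \<open>
  The two Euler errors in a common form. The one number \<open>A\<close> bounds all constants, and \<open>W\<close> is the scale of the initial state,
  later the square root of the Lyapunov function.
\<close>
lemma euler_errors:
  assumes A: "A \<ge> 1" "L \<le> A" "\<Gamma> \<le> A" "2 * A * T \<le> 1" and W: "W \<ge> 0"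
    and v0: "norm (v 0) \<le> A * W" and p: "norm p \<le> A * W"
  shows "norm (x m + noise_x m - x 0 - T *\<^sub>R v 0) \<le> 8 * A ^ 3 * (T\<^sup>2 * W + T * q)"
    and "norm (v m + noise_v m - v 0 + T *\<^sub>R (\<Gamma> *\<^sub>R v 0 + g)) \<le> 8 * A ^ 3 * (T\<^sup>2 * W + T * q)"
    and "T * \<Gamma> \<le> 1"
proof -
  note nn = T_nonneg q_nonneg \<Gamma>_nonneg L_nonneg W
  have TA: "T * A \<le> 1 / 2" using A(4) by (simp add: mult_ac)
  have T_le: "T \<le> 1 / 2" using mult_left_mono[OF A(1) T_nonneg] TA by simp
  show TG: "T * \<Gamma> \<le> 1" using mult_left_mono[OF A(3) T_nonneg] TA by linarith
  have TL: "T * L \<le> 1 / 2" using mult_left_mono[OF A(2) T_nonneg] TA by linarith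
  have T2L: "2 * (T\<^sup>2 * L) \<le> 1"
    using mult_mono[OF T_le TL] nn by (simp add: power2_eq_square algebra_simps)
  define D where "D = 3 * A * T * W + 4 * q"
  have AW: "A * W \<ge> 0" and D0: "D \<ge> 0" using A nn by (auto simp: D_def)
  have D: "norm (x j - x 0) \<le> D" if "j < m" for j
  proof -
    have "T * norm (v 0) \<le> T * (A * W)" using v0 nn by (intro mult_left_mono)
    moreover have "(T * L) * norm p \<le> (1 / 2) * (A * W)" using TL p nn by (intro mult_mono) auto
    then have "T * ((T * L) * norm p) \<le> T * ((1 / 2) * (A * W))" using nn by (intro mult_left_mono)
    ultimately show ?thesis using norm_x_diff[OF TG T2L, of j] that
      by (simp add: D_def power2_eq_square algebra_simps)
  qed
  have LpD: "L * (norm p + D) \<le> A * (A * W + D)" using A p nn D0 by (intro mult_mono) auto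
  have LD: "L * D \<le> A * D" using A D0 by (intro mult_right_mono)
  have A12: "A \<le> A ^ 3" "A ^ 2 \<le> A ^ 3"
    using power_increasing[of 1 3 A] power_increasing[of 2 3 A] A(1) by auto
  have T2W: "T\<^sup>2 * W \<ge> 0" and Tq: "T * q \<ge> 0" using nn by auto
  note m1 = mult_right_mono[OF A12(1) T2W] and m2 = mult_right_mono[OF A12(2) T2W]
    and m3 = mult_right_mono[OF A12(1) Tq] and m4 = mult_right_mono[OF A(1) Tq]
  have nn3: "0 \<le> A ^ 3 * (T\<^sup>2 * W)" "0 \<le> A ^ 3 * (T * q)" using A(1) T2W Tq by auto
  have tad: "(T * A) * (T * A * D) \<le> (1 / 2) * (T * A * D)"
    using TA nn D0 A by (intro mult_right_mono) auto
  have "(T * \<Gamma>)\<^sup>2 \<le> (T * A)\<^sup>2" using A nn by (intro power_mono mult_left_mono) auto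
  then have "(T * \<Gamma>)\<^sup>2 * norm (v 0) \<le> (T * A)\<^sup>2 * (A * W)"
    using v0 by (intro mult_mono) auto
  moreover have "T * \<Gamma> * (T * (L * (norm p + D))) \<le> T * A * (T * (A * (A * W + D)))"
    using A nn by (intro mult_mono[OF _ mult_left_mono[OF LpD]] mult_left_mono) (auto simp: D0)
  moreover have "T * (L * D) \<le> T * (A * D)" using LD nn by (intro mult_left_mono)
  ultimately have "(T * \<Gamma>)\<^sup>2 * norm (v 0) + T * \<Gamma> * (T * (L * (norm p + D))) + T * (L * D)
      \<le> (T * A)\<^sup>2 * (A * W) + T * A * (T * (A * (A * W + D))) + T * (A * D)" by linarith
  also have "\<dots> = 2 * A ^ 3 * (T\<^sup>2 * W) + (T * A) * (T * A * D) + T * A * D"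
    by (simp add: power2_eq_square power3_eq_cube algebra_simps)
  also have "\<dots> \<le> 2 * A ^ 3 * (T\<^sup>2 * W) + (1 / 2) * (T * A * D) + T * A * D"
    by (intro add_mono tad order_refl)
  also have "\<dots> = 2 * A ^ 3 * (T\<^sup>2 * W) + (3 / 2) * (T * A * D)" by simp
  also have "\<dots> = 2 * (A ^ 3 * (T\<^sup>2 * W)) + (9 / 2) * (A\<^sup>2 * (T\<^sup>2 * W)) + 6 * (A * (T * q))"
    by (simp add: D_def power2_eq_square power3_eq_cube algebra_simps)
  also have "\<dots> \<le> 8 * (A ^ 3 * (T\<^sup>2 * W)) + 8 * (A ^ 3 * (T * q))"
    using m2 m3 nn3 by linarith
  finally show "norm (v m + noise_v m - v 0 + T *\<^sub>R (\<Gamma> *\<^sub>R v 0 + g)) \<le> 8 * A ^ 3 * (T\<^sup>2 * W + T * q)"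
    using euler_error_v[OF D] by (simp add: algebra_simps)
  have "T * \<Gamma> * norm (v 0) \<le> T * A * (A * W)" using A v0 nn by (intro mult_mono mult_left_mono) auto
  moreover have "T * (L * (norm p + D)) \<le> T * (A * (A * W + D))"
    using LpD nn by (intro mult_left_mono)
  ultimately have "T * (T * \<Gamma> * norm (v 0) + T * (L * (norm p + D))) \<le> T * (T * A * (A * W) + T * (A * (A * W + D)))"
    using nn by (intro mult_left_mono) auto
  also have "\<dots> = 2 * (A\<^sup>2 * (T\<^sup>2 * W)) + (T * A) * (T * D)"
    by (simp add: power2_eq_square algebra_simps)
  also have "(T * A) * (T * D) \<le> (1 / 2) * (T * D)"
    using TA nn D0 by (intro mult_right_mono) auto
  also have "(1 / 2) * (T * D) = (3 / 2) * (A * (T\<^sup>2 * W)) + 2 * (T * q)"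
    by (simp add: D_def power2_eq_square algebra_simps)
  also have "2 * (A\<^sup>2 * (T\<^sup>2 * W)) + ((3 / 2) * (A * (T\<^sup>2 * W)) + 2 * (T * q))
      \<le> 8 * (A ^ 3 * (T\<^sup>2 * W)) + 8 * (A ^ 3 * (T * q))"
    using m1 m2 m3 m4 nn3 by linarith
  finally show "norm (x m + noise_x m - x 0 - T *\<^sub>R v 0) \<le> 8 * A ^ 3 * (T\<^sup>2 * W + T * q)"
    using euler_error_x[OF D] by (simp add: algebra_simps)
qed

end

section \<open>Change of the Lyapunov function over a perturbed Euler step\<close>

text \<open>
  The Lyapunov function, with \<open>\<phi>\<close> for the excess of the objective and \<open>p\<close> for the position relative to the
  minimiser.
\<close>
definition energy :: "real \<Rightarrow> real \<Rightarrow> 'a::real_inner \<Rightarrow> 'a \<Rightarrow> real" where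
  "energy \<Gamma> \<phi> p v = \<phi> + \<Gamma>\<^sup>2 / 4 * (norm p)\<^sup>2 + \<Gamma> / 2 * inner p v + 1 / 2 * (norm v)\<^sup>2"

text \<open>
  The derivative of the energy at \<open>(p, v)\<close> in the direction \<open>(a, b)\<close>, if the objective has gradient \<open>g\<close> there.
\<close>
definition energy_deriv :: "real \<Rightarrow> 'a::real_inner \<Rightarrow> 'a \<Rightarrow> 'a \<Rightarrow> 'a \<Rightarrow> 'a \<Rightarrow> real" where
  "energy_deriv \<Gamma> g p v a b =
     inner (g + (\<Gamma>\<^sup>2 / 2) *\<^sub>R p + (\<Gamma> / 2) *\<^sub>R v) a + inner ((\<Gamma> / 2) *\<^sub>R p + v) b"

lemma energy_lower:
  fixes p v :: "'a::real_inner"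
  shows "\<phi> + (norm v)\<^sup>2 / 4 \<le> energy \<Gamma> \<phi> p v"
proof -
  have "0 \<le> (norm ((\<Gamma> / 2) *\<^sub>R p + (1 / 2) *\<^sub>R v))\<^sup>2" by simp
  also have "\<dots> = \<Gamma>\<^sup>2 / 4 * (norm p)\<^sup>2 + \<Gamma> / 2 * inner p v + (norm v)\<^sup>2 / 4"
    by (simp add: power2_norm_eq_inner inner_simps inner_commute) (simp add: power2_eq_square field_simps)
  finally show ?thesis by (simp add: energy_def)
qed

lemma energy_upper:
  fixes p v :: "'a::real_inner"
  shows "energy \<Gamma> \<phi> p v \<le> \<phi> + \<Gamma>\<^sup>2 / 2 * (norm p)\<^sup>2 + (norm v)\<^sup>2"
proof -
  have "0 \<le> (norm ((\<Gamma> / 2) *\<^sub>R p - (1 / 2) *\<^sub>R v))\<^sup>2" by simp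
  also have "\<dots> = \<Gamma>\<^sup>2 / 4 * (norm p)\<^sup>2 - \<Gamma> / 2 * inner p v + (norm v)\<^sup>2 / 4"
    by (simp add: power2_norm_eq_inner inner_simps inner_commute) (simp add: power2_eq_square field_simps)
  finally show ?thesis unfolding energy_def using zero_le_power2[of "norm v"] by linarith
qed

text \<open>
  The coefficients of the energy are chosen such that, along the flow with friction \<open>\<Gamma>\<close>, the terms in
  \<open>inner g v\<close> and \<open>inner p v\<close> cancel.
\<close>
lemma energy_deriv_euler:
  fixes p v g :: "'a::real_inner"
  shows "energy_deriv \<Gamma> g p v (T *\<^sub>R v) (- T *\<^sub>R (\<Gamma> *\<^sub>R v + g))
     = - (T * \<Gamma> / 2) * ((norm v)\<^sup>2 + inner g p)"
  by (simp add: energy_deriv_def power2_norm_eq_inner inner_simps inner_commute)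
     (simp add: power2_eq_square field_simps)

lemma energy_increment:
  fixes p v g dx dv :: "'a::real_inner"
  assumes "\<phi>' \<le> \<phi> + inner g dx + L * (norm dx)\<^sup>2"
    and "A \<ge> 1" "L \<le> A" "0 \<le> \<Gamma>" "\<Gamma> \<le> A"
  shows "energy \<Gamma> \<phi>' (p + dx) (v + dv)
    \<le> energy \<Gamma> \<phi> p v + energy_deriv \<Gamma> g p v dx dv + 2 * A\<^sup>2 * ((norm dx)\<^sup>2 + (norm dv)\<^sup>2)"
proof -
  have A2: "A \<le> A\<^sup>2" "1 \<le> A\<^sup>2" "\<Gamma>\<^sup>2 \<le> A\<^sup>2"
    using assms power_increasing[of 1 2 A] by (auto simp: power_mono)
  have "0 \<le> (norm (dx - dv))\<^sup>2" by simp
  then have "2 * inner dx dv \<le> (norm dx)\<^sup>2 + (norm dv)\<^sup>2"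
    by (simp add: power2_norm_eq_inner inner_simps inner_commute)
  then have "\<Gamma> / 4 * (2 * inner dx dv) \<le> \<Gamma> / 4 * ((norm dx)\<^sup>2 + (norm dv)\<^sup>2)"
    using assms by (intro mult_left_mono) auto
  moreover have "energy \<Gamma> \<phi>' (p + dx) (v + dv) \<le> energy \<Gamma> \<phi> p v + energy_deriv \<Gamma> g p v dx dv
      + (L * (norm dx)\<^sup>2 + \<Gamma>\<^sup>2 / 4 * (norm dx)\<^sup>2 + \<Gamma> / 2 * inner dx dv + 1 / 2 * (norm dv)\<^sup>2)"
    using assms(1) unfolding energy_def energy_deriv_def
    by (simp add: power2_norm_eq_inner inner_simps inner_commute algebra_simps)
  moreover have "(L + \<Gamma>\<^sup>2 / 4 + \<Gamma> / 4) * (norm dx)\<^sup>2 \<le> 2 * A\<^sup>2 * (norm dx)\<^sup>2"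
    using assms A2 by (intro mult_right_mono) (linarith | simp)+
  moreover have "(\<Gamma> / 4 + 1 / 2) * (norm dv)\<^sup>2 \<le> 2 * A\<^sup>2 * (norm dv)\<^sup>2"
    using assms A2 by (intro mult_right_mono) auto
  ultimately show ?thesis by (simp add: algebra_simps)
qed

lemma power2_sum3_le: "(a + b + c :: real)\<^sup>2 \<le> 3 * (a\<^sup>2 + b\<^sup>2 + c\<^sup>2)"
  using zero_le_power2[of "a - b"] zero_le_power2[of "b - c"] zero_le_power2[of "a - c"]
  by (simp add: power2_eq_square algebra_simps)

lemma weighted_young: "\<epsilon> > 0 \<Longrightarrow> (a * b :: real) \<le> \<epsilon> * a\<^sup>2 + b\<^sup>2 / (4 * \<epsilon>)"
proof -
  assume e: "\<epsilon> > 0"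
  have "0 \<le> (2 * \<epsilon> * a - b)\<^sup>2 / (4 * \<epsilon>)" using e by simp
  also have "\<dots> = \<epsilon> * a\<^sup>2 - a * b + b\<^sup>2 / (4 * \<epsilon>)"
    using e by (simp add: power2_eq_square field_simps)
  finally show ?thesis by simp
qed

text \<open>
  One perturbed Euler step. The noise \<open>(nx, nv)\<close> may be large and enters linearly, to be averaged out later;
  the errors \<open>(ex, ev)\<close> are small enough to be absorbed by Young's inequality, at the price \<open>\<epsilon> T W\<^sup>2\<close>.
  The number \<open>r\<close> is the decay rate of the flow.
\<close>
lemma energy_drift:
  fixes p v g dx dv nx nv ex ev :: "'a::real_inner"
  assumes f: "\<phi>' \<le> \<phi> + inner g dx + L * (norm dx)\<^sup>2"
    and dx: "dx = T *\<^sub>R v - nx + ex" and dv: "dv = - T *\<^sub>R (\<Gamma> *\<^sub>R v + g) - nv + ev"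
    and A: "A \<ge> 1" "L \<le> A" "0 \<le> \<Gamma>" "\<Gamma> \<le> A" and T: "0 \<le> T" "T \<le> 1" and W: "0 \<le> W"
    and V: "energy \<Gamma> \<phi> p v = W\<^sup>2"
    and bounds: "norm p \<le> A * W" "norm v \<le> A * W" "norm g \<le> A * W"
    and decay: "\<Gamma> * ((norm v)\<^sup>2 + inner g p) \<ge> r * W\<^sup>2"
    and E: "E \<ge> 2 * A\<^sup>2" and q: "q \<ge> 0" and q': "q' \<ge> 0"
    and e: "norm ex \<le> E * (T\<^sup>2 * W + T * q)" "norm ev \<le> E * (T\<^sup>2 * W + T * q)"
    and n: "norm nx \<le> q'" "norm nv \<le> q'"
    and eps: "\<epsilon> > 0"
    and K: "K = 4 * A ^ 3 * E + 4 * A ^ 6 * E\<^sup>2 / \<epsilon> + 48 * A\<^sup>2 * E\<^sup>2"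
  shows "energy \<Gamma> \<phi>' (p + dx) (v + dv) \<le> (1 - T * r / 2 + \<epsilon> * T + K * T\<^sup>2) * W\<^sup>2
      - energy_deriv \<Gamma> g p v nx nv + K * (T * q\<^sup>2 + q'\<^sup>2)"
proof -
  have A2: "A \<le> A\<^sup>2" "A \<le> A ^ 3" "A\<^sup>2 \<le> A ^ 3" "1 \<le> A\<^sup>2" "1 \<le> A ^ 3"
    using A power_increasing[of 1 2 A] power_increasing[of 1 3 A] power_increasing[of 2 3 A] by auto
  have E0: "E \<ge> 0" "A \<le> E" using E A2 by auto
  have Gv: "\<Gamma> * norm v \<le> A * (A * W)" using A bounds by (intro mult_mono) auto
  have Gp: "\<Gamma> * norm p \<le> A * (A * W)" using A bounds by (intro mult_mono) auto
  have "\<Gamma>\<^sup>2 \<le> A\<^sup>2" using A by (intro power_mono)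
  then have G2p: "\<Gamma>\<^sup>2 * norm p \<le> A\<^sup>2 * (A * W)" using bounds by (intro mult_mono) auto
  note W3 = mult_right_mono[OF A2(2) W] mult_right_mono[OF A2(3) W]
  have T2: "T\<^sup>2 \<le> T" using T mult_left_mono[of T 1 T] by (simp add: power2_eq_square)
  define K\<^sub>1 where "K\<^sub>1 = 4 * A ^ 6 * E\<^sup>2 / \<epsilon>"
  have "norm (g + (\<Gamma>\<^sup>2 / 2) *\<^sub>R p + (\<Gamma> / 2) *\<^sub>R v) \<le> norm g + \<Gamma>\<^sup>2 / 2 * norm p + \<Gamma> / 2 * norm v"
    using A by (intro norm_triangle_mono) auto
  also have "\<dots> \<le> 2 * A ^ 3 * W"
    using bounds(3) G2p Gv W3 by (simp add: power2_eq_square power3_eq_cube)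
  finally have c1: "norm (g + (\<Gamma>\<^sup>2 / 2) *\<^sub>R p + (\<Gamma> / 2) *\<^sub>R v) \<le> 2 * A ^ 3 * W" .
  have "norm ((\<Gamma> / 2) *\<^sub>R p + v) \<le> \<Gamma> / 2 * norm p + norm v"
    using A by (intro norm_triangle_mono) auto
  also have "\<dots> \<le> 2 * A ^ 3 * W"
  proof -
    have "A * (A * W) \<le> A ^ 3 * W" using W3(2) by (simp add: power2_eq_square mult.assoc)
    then have "\<Gamma> * norm p \<le> A ^ 3 * W" using Gp by linarith
    moreover have "norm v \<le> A ^ 3 * W" using bounds(2) W3(1) by linarith
    moreover have "0 \<le> A ^ 3 * W" using A W by simp
    ultimately show ?thesis by linarith
  qed
  finally have c2: "norm ((\<Gamma> / 2) *\<^sub>R p + v) \<le> 2 * A ^ 3 * W" .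
  have "energy_deriv \<Gamma> g p v ex ev \<le> 2 * A ^ 3 * W * (E * (T\<^sup>2 * W + T * q)) + 2 * A ^ 3 * W * (E * (T\<^sup>2 * W + T * q))"
    unfolding energy_deriv_def
    using c1 c2 e A W
    by (intro add_mono order_trans[OF norm_cauchy_schwarz] mult_mono) auto
  also have "\<dots> = 4 * A ^ 3 * E * T\<^sup>2 * W\<^sup>2 + T * (W * (4 * A ^ 3 * E * q))"
    by (simp add: power2_eq_square algebra_simps)
  also have "W * (4 * A ^ 3 * E * q) \<le> \<epsilon> * W\<^sup>2 + (4 * A ^ 3 * E * q)\<^sup>2 / (4 * \<epsilon>)"
    by (rule weighted_young[OF eps])
  also have "(4 * A ^ 3 * E * q)\<^sup>2 / (4 * \<epsilon>) = K\<^sub>1 * q\<^sup>2"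
    using eps by (simp add: K\<^sub>1_def power_mult_distrib)
  finally have lin_e: "energy_deriv \<Gamma> g p v ex ev
      \<le> 4 * A ^ 3 * E * T\<^sup>2 * W\<^sup>2 + T * (\<epsilon> * W\<^sup>2 + K\<^sub>1 * q\<^sup>2)"
    using T by (simp add: mult_left_mono)
  have split: "energy_deriv \<Gamma> g p v dx dv
      = energy_deriv \<Gamma> g p v (T *\<^sub>R v) (- T *\<^sub>R (\<Gamma> *\<^sub>R v + g))
        - energy_deriv \<Gamma> g p v nx nv + energy_deriv \<Gamma> g p v ex ev"
    unfolding dx dv by (simp add: energy_deriv_def inner_simps)
  have "T / 2 * (r * W\<^sup>2) \<le> T / 2 * (\<Gamma> * ((norm v)\<^sup>2 + inner g p))"
    using decay T by (intro mult_left_mono) auto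
  then have main: "energy_deriv \<Gamma> g p v (T *\<^sub>R v) (- T *\<^sub>R (\<Gamma> *\<^sub>R v + g)) \<le> - (T * r / 2) * W\<^sup>2"
    unfolding energy_deriv_euler by (simp add: algebra_simps)
    have TW: "T\<^sup>2 * W \<le> T * W" using T2 W by (rule mult_right_mono)
  have TAW: "T * (A * W) \<le> T * (E * W)" using E0 T W by (intro mult_left_mono mult_right_mono)
  have "norm dx \<le> norm (T *\<^sub>R v) + norm nx + norm ex"
    unfolding dx using norm_triangle_ineq[of "T *\<^sub>R v - nx" ex] norm_triangle_ineq4[of "T *\<^sub>R v" nx] by linarith
  moreover have "norm (T *\<^sub>R v) \<le> T * (A * W)" using bounds T by (simp add: mult_left_mono)
  ultimately have ndx: "norm dx \<le> 2 * E * T * W + E * T * q + q'"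
    using n e(1) mult_left_mono[OF TW E0(1)] TAW by (simp add: algebra_simps)
  have "norm dv \<le> norm (T *\<^sub>R (\<Gamma> *\<^sub>R v + g)) + norm nv + norm ev"
    unfolding dv using norm_triangle_ineq[of "- T *\<^sub>R (\<Gamma> *\<^sub>R v + g) - nv" ev]
      norm_triangle_ineq4[of "- T *\<^sub>R (\<Gamma> *\<^sub>R v + g)" nv] by (simp del: scaleR_add_right)
  moreover have "norm (\<Gamma> *\<^sub>R v + g) \<le> E * W"
  proof -
    have "norm (\<Gamma> *\<^sub>R v + g) \<le> \<Gamma> * norm v + norm g" using A norm_triangle_ineq[of "\<Gamma> *\<^sub>R v" g] by simp
    also have "\<dots> \<le> 2 * A\<^sup>2 * W"
      using Gv bounds(3) mult_right_mono[OF A2(1) W] by (simp add: power2_eq_square)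
    also have "\<dots> \<le> E * W" using E W by (rule mult_right_mono)
    finally show ?thesis .
  qed
  then have "norm (T *\<^sub>R (\<Gamma> *\<^sub>R v + g)) \<le> T * (E * W)"
    using T by (simp add: mult_left_mono del: scaleR_add_right)
  ultimately have ndv: "norm dv \<le> 2 * E * T * W + E * T * q + q'"
    using n e(2) mult_left_mono[OF TW E0(1)] by (simp add: algebra_simps)
  let ?S = "3 * ((2 * E * T * W)\<^sup>2 + (E * T * q)\<^sup>2 + q'\<^sup>2)"
  have "(norm dx)\<^sup>2 \<le> ?S" "(norm dv)\<^sup>2 \<le> ?S"
    using power_mono[OF ndx, of 2] power_mono[OF ndv, of 2] power2_sum3_le[of "2 * E * T * W" "E * T * q" q'] by auto
  then have "2 * A\<^sup>2 * ((norm dx)\<^sup>2 + (norm dv)\<^sup>2) \<le> 2 * A\<^sup>2 * (?S + ?S)"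
    by (intro mult_left_mono add_mono) auto
  also have "\<dots> = 48 * A\<^sup>2 * E\<^sup>2 * T\<^sup>2 * W\<^sup>2 + 12 * A\<^sup>2 * E\<^sup>2 * (T\<^sup>2 * q\<^sup>2) + 12 * A\<^sup>2 * q'\<^sup>2"
    by (simp add: power_mult_distrib algebra_simps)
  finally have quad: "2 * A\<^sup>2 * ((norm dx)\<^sup>2 + (norm dv)\<^sup>2) \<le> \<dots>" .
  have B0: "4 * A ^ 3 * E \<ge> 0" "K\<^sub>1 \<ge> 0" "48 * A\<^sup>2 * E\<^sup>2 \<ge> 0"
    using A E0 eps by (auto simp: K\<^sub>1_def)
  have "12 * A\<^sup>2 * E\<^sup>2 * (T\<^sup>2 * q\<^sup>2) \<le> 48 * A\<^sup>2 * E\<^sup>2 * (T * q\<^sup>2)"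
    using T2 T by (intro mult_mono mult_right_mono) auto
  moreover have "1 \<le> E\<^sup>2" using E A2 by (simp add: one_le_power)
  then have "(12 * A\<^sup>2 * q'\<^sup>2) * 1 \<le> (12 * A\<^sup>2 * q'\<^sup>2) * (4 * E\<^sup>2)"
    by (intro mult_left_mono) auto
  then have "12 * A\<^sup>2 * q'\<^sup>2 \<le> 48 * A\<^sup>2 * E\<^sup>2 * q'\<^sup>2"
    by (simp add: mult_ac)
  moreover have "0 \<le> K\<^sub>1 * (T\<^sup>2 * W\<^sup>2)" "0 \<le> 4 * A ^ 3 * E * (T * q\<^sup>2)"
    "0 \<le> 4 * A ^ 3 * E * q'\<^sup>2" "0 \<le> K\<^sub>1 * q'\<^sup>2"
    using B0 T by simp_all
  moreover have "(\<epsilon> * T + K * T\<^sup>2) * W\<^sup>2 + K * (T * q\<^sup>2 + q'\<^sup>2)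
      = T * (\<epsilon> * W\<^sup>2 + K\<^sub>1 * q\<^sup>2) + 4 * A ^ 3 * E * T\<^sup>2 * W\<^sup>2 + 4 * A ^ 3 * E * (T * q\<^sup>2)
        + 4 * A ^ 3 * E * q'\<^sup>2 + K\<^sub>1 * (T\<^sup>2 * W\<^sup>2) + K\<^sub>1 * q'\<^sup>2
        + 48 * A\<^sup>2 * E\<^sup>2 * T\<^sup>2 * W\<^sup>2 + 48 * A\<^sup>2 * E\<^sup>2 * (T * q\<^sup>2) + 48 * A\<^sup>2 * E\<^sup>2 * q'\<^sup>2"
    unfolding K K\<^sub>1_def[symmetric] by (simp only: distrib_left distrib_right mult_ac add_ac)
  ultimately have "energy_deriv \<Gamma> g p v ex ev + 2 * A\<^sup>2 * ((norm dx)\<^sup>2 + (norm dv)\<^sup>2)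
      \<le> (\<epsilon> * T + K * T\<^sup>2) * W\<^sup>2 + K * (T * q\<^sup>2 + q'\<^sup>2)"
    using lin_e quad by linarith
  moreover have "(1 - T * r / 2 + \<epsilon> * T + K * T\<^sup>2) * W\<^sup>2
      = W\<^sup>2 + - (T * r / 2) * W\<^sup>2 + (\<epsilon> * T + K * T\<^sup>2) * W\<^sup>2" by (simp add: algebra_simps)
  ultimately show ?thesis
    using energy_increment[OF f A(1,2,3,4), of p v dv] split main V by linarith
qed

section \<open>Sampling without replacement\<close>

lemma finite_batches: "finite (batches N n)"
  unfolding batches_def by (rule finite_subset[of _ "Pow {1..N}"]) auto

lemma ordered_partition_nth_in_batches:
  assumes "s \<in> ordered_partitions N n R" "i < R"
  shows "s ! i \<in> batches N n"
  using assms nth_mem[of i s] unfolding ordered_partitions_def batches_def partition_on_def by fastforce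

lemma finite_ordered_partitions: "finite (ordered_partitions N n R)"
proof (rule finite_subset)
  show "ordered_partitions N n R \<subseteq> {xs. set xs \<subseteq> Pow {1..N} \<and> length xs = R}"
    unfolding ordered_partitions_def partition_on_def by auto
qed (simp add: finite_lists_length_eq)

text \<open>
  Witness: the consecutive intervals of length \<open>n\<close>.
\<close>
lemma ordered_partitions_nonempty:
  assumes "n > 0" shows "ordered_partitions (n * R) n R \<noteq> {}"
proof -
  let ?b = "\<lambda>i. {i * n + 1..(i + 1) * n}"
  let ?p = "map ?b [0..<R]"
  have disj: "?b i \<inter> ?b j = {}" if "i < j" for i j
  proof -
    have "(i + 1) * n \<le> j * n" using that by (intro mult_right_mono) auto
    then show ?thesis by auto
  qed
  have ne: "?b i \<noteq> {}" for i using assms by auto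
  have inj: "inj ?b"
  proof (rule injI, rule ccontr)
    fix i j assume "?b i = ?b j" "i \<noteq> j"
    then show False using disj[of i j] disj[of j i] ne[of i] by (cases "i < j") auto
  qed
  have "(\<Union>i<R. ?b i) = {1..n * R}"
  proof (induction R)
    case (Suc R)
    then show ?case by (auto simp: lessThan_Suc algebra_simps)
  qed simp
  moreover have "disjoint (?b ` {..<R})"
    by (rule disjointI) (use disj in \<open>metis (no_types, lifting) Int_commute imageE linorder_neqE_nat\<close>)
  moreover have "distinct ?p" using inj by (simp add: distinct_map inj_on_def inj_def)
  moreover have "set ?p = ?b ` {..<R}" by auto
  moreover have "{} \<notin> ?b ` {..<R}" using ne by blast
  ultimately have "?p \<in> ordered_partitions (n * R) n R"
    by (auto simp: ordered_partitions_def partition_on_def)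
  then show ?thesis by blast
qed

lemma sum_ordered_partition:
  fixes a :: "nat \<Rightarrow> 'a::comm_monoid_add"
  assumes "s \<in> ordered_partitions N n R"
  shows "(\<Sum>i<R. \<Sum>j\<in>s ! i. a j) = (\<Sum>j=1..N. a j)"
proof -
  have s: "length s = R" "distinct s" "partition_on {1..N} (set s)"
    using assms by (auto simp: ordered_partitions_def)
  have "(\<Sum>i<R. \<Sum>j\<in>s ! i. a j) = (\<Sum>\<omega>\<in>set s. \<Sum>j\<in>\<omega>. a j)"
    by (rule sum.reindex_bij_betw[OF bij_betw_nth]) (use s in auto)
  also have "\<dots> = sum a (\<Union>(set s))"
  proof (subst sum.Union_disjoint)
    show "\<forall>A\<in>set s. finite A"
      using partition_onD1[OF s(3)] by (metis Sup_upper finite_atLeastAtMost finite_subset)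
    show "\<forall>A\<in>set s. \<forall>B\<in>set s. A \<noteq> B \<longrightarrow> A \<inter> B = {}"
      using partition_onD2[OF s(3)] by (auto dest: disjointD)
  qed simp
  finally show ?thesis using partition_onD1[OF s(3)] by simp
qed

lemma sum_ordered_partitions_swap:
  assumes "i < R" "j < R"
  shows "(\<Sum>s\<in>ordered_partitions N n R. \<phi> (s[i := s ! j, j := s ! i])) = (\<Sum>s\<in>ordered_partitions N n R. \<phi> s)"
proof (rule sum.reindex_bij_witness)
  fix s assume s: "s \<in> ordered_partitions N n R"
  then have l: "length s = R" by (simp add: ordered_partitions_def)
  let ?t = "s[i := s ! j, j := s ! i]"
  show "?t \<in> ordered_partitions N n R" "?t \<in> ordered_partitions N n R"
    using s assms l by (simp_all add: ordered_partitions_def)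
  show "?t[i := ?t ! j, j := ?t ! i] = s" "?t[i := ?t ! j, j := ?t ! i] = s"
    using assms l by (simp_all add: nth_list_update list_eq_iff_nth_eq)
qed auto

lemma sum_ordered_partitions_rev:
  "(\<Sum>s\<in>ordered_partitions N n R. \<phi> (rev s)) = (\<Sum>s\<in>ordered_partitions N n R. \<phi> s)"
  by (rule sum.reindex_bij_witness[of _ rev rev]) (auto simp: ordered_partitions_def)

text \<open>
  Every batch is equally likely at every position, because a permutation of \<open>{1..N}\<close> that maps \<open>\<omega>\<close> to \<open>\<omega>'\<close> acts
  injectively on ordered partitions. Equality follows by exchanging \<open>\<omega>\<close> and \<open>\<omega>'\<close>.
\<close>
lemma card_nth_eq_le:
  assumes "n > 0" "i < R" and \<omega>: "\<omega> \<in> batches N n" "\<omega>' \<in> batches N n"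
  shows "card {s \<in> ordered_partitions N n R. s ! i = \<omega>} \<le> card {s \<in> ordered_partitions N n R. s ! i = \<omega>'}"
proof -
  have sub: "\<omega> \<subseteq> {1..N}" "\<omega>' \<subseteq> {1..N}" and c: "card \<omega> = card \<omega>'"
    using \<omega> by (auto simp: batches_def)
  then have fin: "finite \<omega>" "finite \<omega>'" by (auto intro: finite_subset)
  obtain \<tau>\<^sub>1 where t1: "bij_betw \<tau>\<^sub>1 \<omega> \<omega>'" using finite_same_card_bij[OF fin c] by blast
  have "card ({1..N} - \<omega>) = card ({1..N} - \<omega>')" using sub fin c by (simp add: card_Diff_subset)
  then obtain \<tau>\<^sub>2 where t2: "bij_betw \<tau>\<^sub>2 ({1..N} - \<omega>) ({1..N} - \<omega>')"
    using finite_same_card_bij[of "{1..N} - \<omega>" "{1..N} - \<omega>'"] by blast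
  define \<tau> where "\<tau> k = (if k \<in> \<omega> then \<tau>\<^sub>1 k else \<tau>\<^sub>2 k)" for k
  have b1: "bij_betw \<tau> \<omega> \<omega>'" using t1 by (subst bij_betw_cong[of \<omega> \<tau> \<tau>\<^sub>1]) (auto simp: \<tau>_def)
  have b2: "bij_betw \<tau> ({1..N} - \<omega>) ({1..N} - \<omega>')"
    using t2 by (subst bij_betw_cong[of _ \<tau> \<tau>\<^sub>2]) (auto simp: \<tau>_def)
  have "bij_betw \<tau> (\<omega> \<union> ({1..N} - \<omega>)) (\<omega>' \<union> ({1..N} - \<omega>'))"
    by (rule bij_betw_combine[OF b1 b2]) auto
  then have b: "bij_betw \<tau> {1..N} {1..N}" using sub by (simp add: Un_absorb1)
  have inj: "inj_on \<tau> {1..N}" and im: "\<tau> ` {1..N} = {1..N}" using b by (auto simp: bij_betw_def)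
  have injI: "inj_on ((`) \<tau>) (Pow {1..N})" using inj by (rule inj_on_image_Pow)
  show ?thesis
  proof (rule card_inj_on_le)
    have sets: "set s \<subseteq> Pow {1..N}" if "s \<in> ordered_partitions N n R" for s
      using that by (auto simp: ordered_partitions_def partition_on_def)
    show "inj_on (map ((`) \<tau>)) {s \<in> ordered_partitions N n R. s ! i = \<omega>}"
      by (rule inj_on_mapI, rule inj_on_subset[OF injI]) (use sets in blast)
    show "map ((`) \<tau>) ` {s \<in> ordered_partitions N n R. s ! i = \<omega>} \<subseteq> {s \<in> ordered_partitions N n R. s ! i = \<omega>'}"
    proof (rule image_subsetI)
      fix s assume "s \<in> {s \<in> ordered_partitions N n R. s ! i = \<omega>}"
      then have s: "s \<in> ordered_partitions N n R" "s ! i = \<omega>" by auto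
      note ss = sets[OF s(1)]
      have l: "length s = R" "distinct s" "\<forall>\<omega>\<in>set s. card \<omega> = n" "partition_on {1..N} (set s)"
        using s by (auto simp: ordered_partitions_def)
      have "distinct (map ((`) \<tau>) s)" using l(2) inj_on_subset[OF injI ss] by (simp add: distinct_map)
      moreover have cards: "\<forall>\<omega>\<in>set (map ((`) \<tau>) s). card \<omega> = n"
        using l(3) ss by (auto simp: card_image inj_on_subset[OF inj])
      moreover have "partition_on {1..N} (set (map ((`) \<tau>) s))"
      proof -
        have "{} \<notin> (`) \<tau> ` set s" using partition_onD3[OF l(4)] by auto
        then show ?thesis using partition_on_inj_image[OF l(4) inj] unfolding im by simp
      qed
      moreover have "map ((`) \<tau>) s ! i = \<omega>'" using s(2) assms(2) l(1) b1 by (simp add: bij_betw_def)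
      ultimately show "map ((`) \<tau>) s \<in> {s \<in> ordered_partitions N n R. s ! i = \<omega>'}"
        using l(1) by (simp add: ordered_partitions_def)
    qed
    show "finite {s \<in> ordered_partitions N n R. s ! i = \<omega>'}" by (simp add: finite_ordered_partitions)
  qed
qed

lemma sum_ordered_partitions_nth:
  fixes \<phi> :: "nat set \<Rightarrow> real"
  assumes "n > 0" "i < R" "batches N n \<noteq> {}"
  shows "(\<Sum>s\<in>ordered_partitions N n R. \<phi> (s ! i))
    = real (card (ordered_partitions N n R)) * ((\<Sum>\<omega>\<in>batches N n. \<phi> \<omega>) / real (card (batches N n)))"
proof -
  let ?P = "ordered_partitions N n R" and ?B = "batches N n"
  obtain \<omega>\<^sub>0 where w0: "\<omega>\<^sub>0 \<in> ?B" using assms by blast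
  define c where "c = real (card {s \<in> ?P. s ! i = \<omega>\<^sub>0})"
  have eq: "(\<Sum>s\<in>?P. \<psi> (s ! i)) = c * (\<Sum>\<omega>\<in>?B. \<psi> \<omega>)" for \<psi> :: "nat set \<Rightarrow> real"
  proof -
    have "(\<Sum>s\<in>?P. \<psi> (s ! i)) = (\<Sum>\<omega>\<in>?B. \<Sum>s\<in>{s \<in> ?P. s ! i = \<omega>}. \<psi> (s ! i))"
      using assms ordered_partition_nth_in_batches
      by (intro sum.group[symmetric] finite_ordered_partitions finite_batches) auto
    also have "\<dots> = (\<Sum>\<omega>\<in>?B. c * \<psi> \<omega>)"
    proof (rule sum.cong[OF refl])
      fix \<omega> assume w: "\<omega> \<in> ?B"
      have "card {s \<in> ?P. s ! i = \<omega>} = card {s \<in> ?P. s ! i = \<omega>\<^sub>0}"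
        using card_nth_eq_le[OF assms(1,2) w w0] card_nth_eq_le[OF assms(1,2) w0 w] by simp
      then show "(\<Sum>s\<in>{s \<in> ?P. s ! i = \<omega>}. \<psi> (s ! i)) = c * \<psi> \<omega>" by (simp add: c_def)
    qed
    finally show ?thesis by (simp add: sum_distrib_left)
  qed
  have "real (card ?P) = c * real (card ?B)" using eq[of "\<lambda>_. 1"] by simp
  moreover have "card ?B \<noteq> 0" using assms(3) finite_batches by simp
  ultimately show ?thesis using eq[of \<phi>] by simp
qed

text \<open>
  By exchangeability all positions have the same mean, and these means add up to \<open>0\<close>.
\<close>
lemma sum_nth_eq_0:
  fixes G :: "nat set \<Rightarrow> 'a::real_vector"
  assumes zero: "\<And>s. s \<in> ordered_partitions N n R \<Longrightarrow> (\<Sum>i<R. G (s ! i)) = 0" and i: "i < R"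
  shows "(\<Sum>s\<in>ordered_partitions N n R. G (s ! i)) = 0"
proof -
  let ?P = "ordered_partitions N n R"
  have eq: "(\<Sum>s\<in>?P. G (s ! j)) = (\<Sum>s\<in>?P. G (s ! i))" if j: "j < R" for j
  proof -
    have "(\<Sum>s\<in>?P. G (s ! j)) = (\<Sum>s\<in>?P. G (s[i := s ! j, j := s ! i] ! i))"
      using i j by (intro sum.cong) (auto simp: ordered_partitions_def nth_list_update)
    then show ?thesis using sum_ordered_partitions_swap[OF i j, of "\<lambda>s. G (s ! i)"] by simp
  qed
  have "real R *\<^sub>R (\<Sum>s\<in>?P. G (s ! i)) = (\<Sum>j<R. \<Sum>s\<in>?P. G (s ! j))"
    by (simp add: eq sum_constant_scaleR)
  also have "\<dots> = (\<Sum>s\<in>?P. \<Sum>j<R. G (s ! j))" by (rule sum.swap)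
  also have "\<dots> = 0" using zero by simp
  finally show ?thesis using i by simp
qed

text \<open>
  Negative correlation of sampling without replacement: by exchangeability the \<open>R - 1\<close> correlations of position
  \<open>i\<close> with the others are equal, and since the values add up to \<open>0\<close>, they sum up to minus the variance.
\<close>
lemma sum_inner_nth_nonpos:
  fixes G :: "nat set \<Rightarrow> 'a::real_inner"
  assumes zero: "\<And>s. s \<in> ordered_partitions N n R \<Longrightarrow> (\<Sum>i<R. G (s ! i)) = 0"
    and i: "i < R" and j: "j < R" and "i \<noteq> j"
  shows "(\<Sum>s\<in>ordered_partitions N n R. inner (G (s ! i)) (G (s ! j))) \<le> 0"
proof -
  let ?P = "ordered_partitions N n R"
  let ?c = "\<lambda>k. \<Sum>s\<in>?P. inner (G (s ! i)) (G (s ! k))"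
  have eq: "?c k = ?c j" if k: "k < R" "k \<noteq> i" for k
  proof -
    have "?c k = (\<Sum>s\<in>?P. inner (G (s[j := s ! k, k := s ! j] ! i)) (G (s[j := s ! k, k := s ! j] ! j)))"
      using i j k \<open>i \<noteq> j\<close> by (intro sum.cong) (auto simp: ordered_partitions_def nth_list_update)
    then show ?thesis
      using sum_ordered_partitions_swap[OF j k(1), of "\<lambda>s. inner (G (s ! i)) (G (s ! j))"] by simp
  qed
  have "0 = (\<Sum>s\<in>?P. inner (G (s ! i)) (\<Sum>k<R. G (s ! k)))" using zero by simp
  also have "\<dots> = (\<Sum>k<R. ?c k)"
    by (simp add: inner_sum_right) (rule sum.swap)
  also have "\<dots> = ?c i + (\<Sum>k\<in>{..<R} - {i}. ?c k)" using i by (intro sum.remove) auto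
  also have "(\<Sum>k\<in>{..<R} - {i}. ?c k) = (\<Sum>k\<in>{..<R} - {i}. ?c j)"
    by (rule sum.cong) (use eq in auto)
  also have "\<dots> = real (R - 1) * ?c j" using i by simp
  finally have "real (R - 1) * ?c j = - ?c i" by simp
  moreover have "?c i \<ge> 0" by (intro sum_nonneg) simp
  moreover have "real (R - 1) > 0" using i j \<open>i \<noteq> j\<close> by simp
  ultimately show ?thesis by (smt (verit) mult_pos_pos)
qed

lemma sum_norm_partial_sum_le:
  fixes G :: "nat set \<Rightarrow> 'a::real_inner"
  assumes zero: "\<And>s. s \<in> ordered_partitions N n R \<Longrightarrow> (\<Sum>i<R. G (s ! i)) = 0"
    and B: "\<And>i. i < R \<Longrightarrow> (\<Sum>s\<in>ordered_partitions N n R. (norm (G (s ! i)))\<^sup>2) = B"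
    and "k \<le> R"
  shows "(\<Sum>s\<in>ordered_partitions N n R. (norm (\<Sum>i<k. G (s ! i)))\<^sup>2) \<le> real k * B"
  using \<open>k \<le> R\<close>
proof (induction k)
  case (Suc k)
  let ?P = "ordered_partitions N n R"
  have "(\<Sum>s\<in>?P. (norm (\<Sum>i<Suc k. G (s ! i)))\<^sup>2)
      = (\<Sum>s\<in>?P. (norm (\<Sum>i<k. G (s ! i)))\<^sup>2) + (\<Sum>s\<in>?P. (norm (G (s ! k)))\<^sup>2)
        + 2 * (\<Sum>s\<in>?P. \<Sum>i<k. inner (G (s ! i)) (G (s ! k)))"
  proof -
    have "(norm (a + b))\<^sup>2 = (norm a)\<^sup>2 + (norm b)\<^sup>2 + 2 * inner a b" for a b :: 'a
      by (simp add: power2_norm_eq_inner inner_simps inner_commute)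
    then show ?thesis by (simp add: inner_sum_left sum.distrib sum_distrib_left)
  qed
  also have "(\<Sum>s\<in>?P. \<Sum>i<k. inner (G (s ! i)) (G (s ! k))) = (\<Sum>i<k. \<Sum>s\<in>?P. inner (G (s ! i)) (G (s ! k)))"
    by (rule sum.swap)
  also have "\<dots> \<le> 0"
    using Suc.prems by (intro sum_nonpos sum_inner_nth_nonpos[OF zero]) auto
  finally show ?case using Suc B[of k] by (simp add: algebra_simps)
qed simp

section \<open>Expectations over sequences of independent uniform choices\<close>

text \<open>
  A function of finitely many choices from a finite set is integrable, so that measurability need not be traced through
  the recursion of the iterates.
\<close>
definition depends_on_prefix :: "nat \<Rightarrow> ((nat \<Rightarrow> 'a) \<Rightarrow> 'b) \<Rightarrow> bool" where
  "depends_on_prefix m f \<longleftrightarrow> (\<forall>\<xi> \<xi>'. (\<forall>i<m. \<xi> i = \<xi>' i) \<longrightarrow> f \<xi> = f \<xi>')"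

lemma depends_on_prefix_case_nat:
  assumes "depends_on_prefix (Suc m) f" shows "depends_on_prefix m (\<lambda>\<xi>. f (case_nat s \<xi>))"
  using assms unfolding depends_on_prefix_def by (auto split: nat.split)

locale uniform_sequence =
  fixes A :: "'a set"
  assumes finite_A: "finite A" and nonempty_A: "A \<noteq> {}"
begin

abbreviation U where "U \<equiv> uniform_count_measure A"
abbreviation M where "M \<equiv> PiM (UNIV :: nat set) (\<lambda>_. U)"

sublocale U: prob_space U
  using finite_A nonempty_A by (rule prob_space_uniform_count_measure)

sublocale sequence_space U
  by unfold_locales

lemma integral_U: "integral\<^sup>L U f = (\<Sum>s\<in>A. f s) / real (card A)" for f :: "'a \<Rightarrow> real"
  using finite_A unfolding uniform_count_measure_def
  by (subst lebesgue_integral_point_measure_finite) (auto simp: sum_divide_distrib)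

text \<open>
  Conditioning on the first choice. Measurability and integrability of \<open>f\<close> are part of the conclusion: they follow from
  those of the sections, as there are only finitely many of these.
\<close>
lemma integral_peel:
  fixes f :: "(nat \<Rightarrow> 'a) \<Rightarrow> real"
  assumes int: "\<And>s. s \<in> A \<Longrightarrow> integrable M (\<lambda>\<xi>. f (case_nat s \<xi>))"
  shows "integrable M f" and "integral\<^sup>L M f = (\<Sum>s\<in>A. \<integral>\<xi>. f (case_nat s \<xi>) \<partial>M) / real (card A)"
proof -
  let ?g = "\<lambda>(s, \<xi>). f (case_nat s \<xi>)"
  interpret UM: pair_sigma_finite U M
    by (simp add: pair_sigma_finite_def prob_space_imp_sigma_finite U.prob_space_axioms P.prob_space_axioms)
  have meas_g: "?g \<in> borel_measurable (U \<Otimes>\<^sub>M M)"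
  proof -
    have "?g \<in> borel_measurable (count_space A \<Otimes>\<^sub>M M)"
      using finite_A int by (intro measurable_pair_measure_countable1) (auto intro: countable_finite)
    also have "measurable (count_space A \<Otimes>\<^sub>M M) borel = measurable (U \<Otimes>\<^sub>M M) (borel :: real measure)"
      by (intro measurable_cong_sets sets_pair_measure_cong) (simp_all add: sets_uniform_count_measure_count_space)
    finally show ?thesis .
  qed
  have int_U: "integrable U h" for h :: "'a \<Rightarrow> real"
    unfolding uniform_count_measure_def by (rule integrable_point_measure_finite[OF finite_A])
  have int_g: "integrable (U \<Otimes>\<^sub>M M) ?g"
  proof (rule UM.Fubini_integrable[OF meas_g])
    show "integrable U (\<lambda>x. \<integral>y. norm (?g (x, y)) \<partial>M)" by (rule int_U)
    show "AE x in U. integrable M (\<lambda>y. ?g (x, y))"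
      using int by (auto intro!: AE_I2 simp: space_uniform_count_measure)
  qed
  have meas_shift: "(\<lambda>\<xi>. (\<xi> 0, \<lambda>i. \<xi> (Suc i))) \<in> measurable M (U \<Otimes>\<^sub>M M)"
    by (intro measurable_Pair measurable_component_singleton measurable_PiM_single')
       (auto simp: space_PiM PiE_iff)
  have "(\<lambda>\<xi>. ?g (\<xi> 0, \<lambda>i. \<xi> (Suc i))) \<in> borel_measurable M"
    using measurable_compose[OF meas_shift meas_g] .
  moreover have "case_nat (\<xi> 0) (\<lambda>i. \<xi> (Suc i)) = \<xi>" for \<xi> :: "nat \<Rightarrow> 'a"
    by (auto split: nat.split)
  ultimately have meas_f: "f \<in> borel_measurable M" by simp
  have meas_cons: "(\<lambda>(s, \<xi>). case_nat s \<xi>) \<in> measurable (U \<Otimes>\<^sub>M M) M"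
    by measurable
  have comp: "(\<lambda>z. f (case z of (s, \<xi>) \<Rightarrow> case_nat s \<xi>)) = ?g" by auto
  show "integrable M f"
    using integrable_distr_eq[OF meas_cons meas_f] int_g unfolding PiM_iter comp by simp
  have "integral\<^sup>L M f = integral\<^sup>L (U \<Otimes>\<^sub>M M) ?g"
    using integral_distr[OF meas_cons meas_f] unfolding PiM_iter comp by simp
  also have "\<dots> = (\<integral>s. \<integral>\<xi>. ?g (s, \<xi>) \<partial>M \<partial>U)" using UM.integral_fst'[OF int_g] by simp
  finally show "integral\<^sup>L M f = (\<Sum>s\<in>A. \<integral>\<xi>. f (case_nat s \<xi>) \<partial>M) / real (card A)"
    by (simp add: integral_U)
qed

lemma integrable_prefix:
  fixes f :: "(nat \<Rightarrow> 'a) \<Rightarrow> real"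
  assumes "depends_on_prefix m f" shows "integrable M f"
  using assms
proof (induction m arbitrary: f)
  case 0
  then have "f = (\<lambda>_. f undefined)" by (auto simp: depends_on_prefix_def)
  then show ?case using P.integrable_const[of "f undefined"] by simp
next
  case (Suc m)
  show ?case by (rule integral_peel(1)) (rule Suc.IH[OF depends_on_prefix_case_nat[OF Suc.prems]])
qed

end

section \<open>Gradients on \<open>\<real>\<^sup>d\<close>\<close>

lemma subspace_Rd: "subspace (Rd d)"
  by (auto simp: subspace_def Rd_def)

definition unit_vec :: "nat \<Rightarrow> fseq" where
  "unit_vec i = Abs_fseq (\<lambda>j. if j = i then 1 else 0)"

lemma coord_unit_vec: "coord (unit_vec i) j = (if j = i then 1 else 0)"
proof -
  have "finite {j. (if j = i then 1 else 0 :: real) \<noteq> 0}" by simp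
  then show ?thesis by (simp add: unit_vec_def Abs_fseq_inverse)
qed

lemma coord_sum: "coord (\<Sum>i\<in>A. x i) j = (\<Sum>i\<in>A. coord (x i) j)"
  by (induction A rule: infinite_finite_induct) auto

lemma Rd_eq_sum_unit_vec:
  assumes "y \<in> Rd d" shows "y = (\<Sum>i<d. coord y i *\<^sub>R unit_vec i)"
proof (rule fseq_eqI)
  fix j
  have "(\<Sum>i<d. coord y i * (if j = i then 1 else 0)) = (if j < d then coord y j else 0)"
    by (simp add: if_distrib sum.delta cong: if_cong)
  then show "coord y j = coord (\<Sum>i<d. coord y i *\<^sub>R unit_vec i) j"
    using assms by (simp add: coord_sum coord_unit_vec Rd_def)
qed

lemma inner_unit_vec: "inner (unit_vec i) y = coord y i"
  by (subst inner_fseq_superset[of "{i}"]) (auto simp: coord_unit_vec)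

text \<open>
  A derivative within \<open>Rd d\<close> is determined only on \<open>Rd d\<close>; outside it can be altered, in particular to an inner product.
\<close>
lemma has_derivative_within_Rd_cong:
  assumes D: "(g has_derivative D) (at x within Rd d)" and x: "x \<in> Rd d"
    and D': "bounded_linear D'" and eq: "\<And>y. y \<in> Rd d \<Longrightarrow> D y = D' y"
  shows "(g has_derivative D') (at x within Rd d)"
proof -
  have "D (y - x) = D' (y - x)" if "y \<in> Rd d" for y
    by (rule eq) (rule subspace_diff[OF subspace_Rd that x])
  then have "((\<lambda>y. (1 / norm (y - x)) *\<^sub>R (g y - (g x + D' (y - x)))) \<longlongrightarrow> 0) (at x within Rd d)
      \<longleftrightarrow> ((\<lambda>y. (1 / norm (y - x)) *\<^sub>R (g y - (g x + D (y - x)))) \<longlongrightarrow> 0) (at x within Rd d)"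
    by (intro Lim_cong_within refl) simp
  then show ?thesis using D D' by (simp add: has_derivative_within)
qed

lemma has_derivative_inner_Rd_unique:
  assumes "(g has_derivative inner G) (at x within Rd d)" "(g has_derivative inner G') (at x within Rd d)"
    and "x \<in> Rd d" "G \<in> Rd d" "G' \<in> Rd d"
  shows "G = G'"
proof -
  let ?u = "G - G'"
  let ?l = "\<lambda>t::real. x + t *\<^sub>R ?u"
  have l: "range ?l \<subseteq> Rd d"
    using assms(3-5) by (auto intro!: subspace_add subspace_diff subspace_scale subspace_Rd)
  have dl: "(?l has_derivative (\<lambda>t. t *\<^sub>R ?u)) (at 0)"
    by (auto intro!: derivative_eq_intros)
  have "((\<lambda>t. g (?l t)) has_derivative (\<lambda>t. inner H (t *\<^sub>R ?u))) (at 0)"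
    if "(g has_derivative inner H) (at x within Rd d)" for H
  proof -
    have "(g has_derivative inner H) (at (?l 0) within range ?l)"
      using has_derivative_subset[OF that l] by simp
    then show ?thesis using has_derivative_in_compose[OF dl, of g "inner H"] by blast
  qed
  from has_derivative_unique[OF this[OF assms(1)] this[OF assms(2)]]
  have "inner G (1 *\<^sub>R ?u) = inner G' (1 *\<^sub>R ?u)" by (rule fun_cong)
  then have "inner ?u ?u = 0" by (simp add: inner_diff_left)
  then show ?thesis by simp
qed

lemma grad_eqI:
  assumes "(g has_derivative inner G) (at x within Rd d)" "x \<in> Rd d" "G \<in> Rd d"
  shows "grad d g x = G"
  unfolding grad_def
proof (rule the_equality)
  show "G \<in> Rd d \<and> (g has_derivative inner G) (at x within Rd d)" using assms by simp
  fix H assume H: "H \<in> Rd d \<and> (g has_derivative inner H) (at x within Rd d)"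
  show "H = G"
    by (rule has_derivative_inner_Rd_unique[OF conjunct2[OF H] assms(1,2) conjunct1[OF H] assms(3)])
qed

lemma grad_exists:
  assumes "g differentiable_on Rd d" "x \<in> Rd d"
  shows "grad d g x \<in> Rd d" "(g has_derivative inner (grad d g x)) (at x within Rd d)"
proof -
  \<comment> \<open>The gradient consists of the partial derivatives in the first \<open>d\<close> directions.\<close>
  obtain D where D: "(g has_derivative D) (at x within Rd d)"
    using assms unfolding differentiable_on_def differentiable_def by blast
  then interpret bounded_linear D by (rule has_derivative_bounded_linear)
  define G where "G = (\<Sum>i<d. D (unit_vec i) *\<^sub>R unit_vec i)"
  have G: "G \<in> Rd d"
    unfolding G_def by (intro subspace_sum subspace_scale subspace_Rd) (auto simp: Rd_def coord_unit_vec)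
  have "D y = inner G y" if "y \<in> Rd d" for y
  proof -
    have "D y = D (\<Sum>i<d. coord y i *\<^sub>R unit_vec i)" by (rule arg_cong[OF Rd_eq_sum_unit_vec[OF that]])
    also have "\<dots> = inner G y"
      by (simp add: G_def sum scaleR inner_sum_left inner_unit_vec mult.commute[of "D _"])
    finally show ?thesis .
  qed
  then have "(g has_derivative inner G) (at x within Rd d)"
    by (rule has_derivative_within_Rd_cong[OF D assms(2) bounded_linear_inner_right])
  moreover from this have "grad d g x = G" by (rule grad_eqI[OF _ assms(2) G])
  ultimately show "grad d g x \<in> Rd d" "(g has_derivative inner (grad d g x)) (at x within Rd d)"
    using G by auto
qed

lemma grad_batch_fun:
  assumes "\<And>i. i \<in> \<omega> \<Longrightarrow> f i differentiable_on Rd d" "x \<in> Rd d"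
  shows "grad d (batch_fun n f \<omega>) x = (1 / real n) *\<^sub>R (\<Sum>i\<in>\<omega>. grad d (f i) x)"
proof (rule grad_eqI[OF _ assms(2)])
  have "((\<lambda>y. 1 / real n * (\<Sum>i\<in>\<omega>. f i y)) has_derivative
      (\<lambda>y. 1 / real n * (\<Sum>i\<in>\<omega>. inner (grad d (f i) x) y))) (at x within Rd d)"
    by (rule has_derivative_mult_right, rule has_derivative_sum)
       (rule grad_exists(2)[OF assms(1) assms(2)])
  moreover have "(\<lambda>y. 1 / real n * (\<Sum>i\<in>\<omega>. inner (grad d (f i) x) y))
      = inner ((1 / real n) *\<^sub>R (\<Sum>i\<in>\<omega>. grad d (f i) x))"
    by (simp add: inner_sum_left fun_eq_iff)
  moreover have "(\<lambda>y. 1 / real n * (\<Sum>i\<in>\<omega>. f i y)) = batch_fun n f \<omega>"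
    by (simp add: batch_fun_def fun_eq_iff)
  ultimately show "(batch_fun n f \<omega> has_derivative inner ((1 / real n) *\<^sub>R (\<Sum>i\<in>\<omega>. grad d (f i) x)))
      (at x within Rd d)" by simp
  show "(1 / real n) *\<^sub>R (\<Sum>i\<in>\<omega>. grad d (f i) x) \<in> Rd d"
    by (intro subspace_scale subspace_sum subspace_Rd grad_exists(1) assms)
qed

section \<open>One pair of epochs\<close>

lemma heavy_ball_add:
  "heavy_ball d n f \<gamma> h x v \<omega> (k + j) =
     heavy_ball d n f \<gamma> h (fst (heavy_ball d n f \<gamma> h x v \<omega> k)) (snd (heavy_ball d n f \<gamma> h x v \<omega> k))
       (\<lambda>i. \<omega> (k + i)) j"
  by (induction j) simp_all

lemma heavy_ball_cong:
  "(\<And>i. i < k \<Longrightarrow> \<omega> i = \<omega>' i) \<Longrightarrow> heavy_ball d n f \<gamma> h x v \<omega> k = heavy_ball d n f \<gamma> h x v \<omega>' k"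
  by (induction k) simp_all

lemma lyapunov_eq_energy:
  "lyapunov F Xs \<gamma> h z = energy (gamma_h \<gamma> h) (F (fst z) - F Xs) (fst z - Xs) (snd z)"
  by (cases z) (simp add: lyapunov_def energy_def)

lemma gamma_h_eq: "gamma_h \<gamma> h = (exp (\<gamma> * h) - 1) / h"
  by (cases "h = 0") (simp_all add: gamma_h_def exp_minus field_simps)

lemma exp_gamma_h: "h > 0 \<Longrightarrow> exp (- \<gamma> * h) * (1 + h * gamma_h \<gamma> h) = 1"
  by (simp add: gamma_h_eq exp_minus field_simps)

lemma gamma_h_lower: "h > 0 \<Longrightarrow> \<gamma> \<le> gamma_h \<gamma> h"
  using exp_ge_add_one_self[of "\<gamma> * h"] by (simp add: gamma_h_eq field_simps)

lemma gamma_h_upper: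
  assumes "h > 0" "\<gamma> > 0" "\<gamma> * h \<le> 1" shows "gamma_h \<gamma> h \<le> 2 * \<gamma>"
proof -
  have "exp (\<gamma> * h) \<le> 1 + \<gamma> * h + (\<gamma> * h)\<^sup>2" using assms by (intro exp_bound) auto
  also have "(\<gamma> * h)\<^sup>2 \<le> \<gamma> * h"
    using assms mult_left_mono[of "\<gamma> * h" 1 "\<gamma> * h"] by (simp add: power2_eq_square)
  finally show ?thesis using assms by (simp add: gamma_h_eq field_simps)
qed

text \<open>
  An upper bound for \<open>L\<close>, for \<open>gamma_h \<gamma> h\<close> if \<open>\<gamma> h \<le> 1\<close>, and for the norms of momentum, displacement and full gradient
  relative to the square root of the Lyapunov function.
\<close>
definition bound_const :: "real \<Rightarrow> real \<Rightarrow> real \<Rightarrow> real" where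
  "bound_const \<mu> L \<gamma> = 2 + L + 2 * \<gamma> + (1 + L) * sqrt (2 / \<mu>)"

text \<open>
  The constant of \<open>energy_drift\<close>. In comparison with the factor \<open>8\<close> of \<open>euler_errors\<close>, the factor \<open>10\<close>
  leaves room for the linear noise of a symmetric pair of epochs, which there counts as an error.
\<close>
definition drift_const :: "real \<Rightarrow> real \<Rightarrow> real \<Rightarrow> real \<Rightarrow> real" where
  "drift_const \<mu> L \<gamma> \<epsilon> = (let A = bound_const \<mu> L \<gamma>; E = 10 * A ^ 3
     in 4 * A ^ 3 * E + 4 * A ^ 6 * E\<^sup>2 / \<epsilon> + 48 * A\<^sup>2 * E\<^sup>2)"

locale heavy_ball_problem =
  fixes \<mu> L \<gamma> :: real and d N n R :: nat and F :: "fseq \<Rightarrow> real" and f :: "nat \<Rightarrow> fseq \<Rightarrow> real"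
    and Xs :: fseq and h :: real
  assumes \<gamma>_pos: "\<gamma> > 0" and \<mu>_pos: "\<mu> > 0" and L_pos: "L > 0" and h_pos: "h > 0"
    and N_eq: "N = n * R" and n_less: "n < N"
    and diff_f: "\<And>i. i \<in> {1..N} \<Longrightarrow> f i differentiable_on Rd d"
    and grad_F: "\<And>x. x \<in> Rd d \<Longrightarrow> grad d F x = (1 / real N) *\<^sub>R (\<Sum>i=1..N. grad d (f i) x)"
    and smooth_F: "smooth d L F" and convex_F: "strongly_convex d \<mu> F"
    and Xs: "Xs \<in> Rd d" and min: "\<And>x. x \<in> Rd d \<Longrightarrow> F Xs \<le> F x"
    and smooth_batch: "\<And>\<omega>. \<omega> \<in> batches N n \<Longrightarrow> smooth d L (batch_fun n f \<omega>)"
begin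

abbreviation "\<P> \<equiv> ordered_partitions N n R"
abbreviation "gF \<equiv> grad d F"
abbreviation "gB \<omega> \<equiv> grad d (batch_fun n f \<omega>)"
abbreviation "G l i \<equiv> gB (l ! i) Xs"
abbreviation "\<Gamma> \<equiv> gamma_h \<gamma> h"
abbreviation "\<eta> \<equiv> exp (- \<gamma> * h)"
abbreviation "V \<equiv> lyapunov F Xs \<gamma> h"
abbreviation "A \<equiv> bound_const \<mu> L \<gamma>"
abbreviation "T \<equiv> h * real (2 * R)"
abbreviation "rate \<equiv> min \<gamma> (\<mu> * \<gamma> / \<Gamma>\<^sup>2)"

text \<open>
  The state after a pair of epochs with the batches in \<open>l\<close>.
\<close>
definition run :: "nat set list \<Rightarrow> fseq \<times> fseq \<Rightarrow> fseq \<times> fseq" where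
  "run l z = heavy_ball d n f \<gamma> h (fst z) (snd z) (\<lambda>k. l ! k) (2 * R)"

definition batch_noise :: "nat set list \<Rightarrow> real" where
  "batch_noise l = (\<Sum>k<2 * R. norm (\<Sum>i<k. G l i))"

definition linear_noise :: "fseq \<times> fseq \<Rightarrow> nat set list \<Rightarrow> real" where
  "linear_noise z l = energy_deriv \<Gamma> (gF (fst z)) (fst z - Xs) (snd z)
     (position_noise \<eta> h (G l) (2 * R)) (momentum_noise \<eta> h (G l) (2 * R))"

lemma n_pos: "n > 0" using N_eq n_less by (cases n) auto
lemma R_pos: "R > 0" using N_eq n_less by (cases R) auto

lemma grad_batch: "\<omega> \<in> batches N n \<Longrightarrow> x \<in> Rd d \<Longrightarrow> gB \<omega> x = (1 / real n) *\<^sub>R (\<Sum>i\<in>\<omega>. grad d (f i) x)"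
  by (rule grad_batch_fun, rule diff_f) (auto simp: batches_def)

lemma grad_batch_Rd: "\<omega> \<in> batches N n \<Longrightarrow> x \<in> Rd d \<Longrightarrow> gB \<omega> x \<in> Rd d"
  by (subst grad_batch)
     (auto simp: batches_def intro!: subspace_scale subspace_sum subspace_Rd grad_exists diff_f)

lemma grad_F_Rd: "x \<in> Rd d \<Longrightarrow> gF x \<in> Rd d"
  by (subst grad_F) (auto intro!: subspace_scale subspace_sum subspace_Rd grad_exists diff_f)

lemma sum_grad_batch:
  assumes "s \<in> \<P>" "x \<in> Rd d"
  shows "(\<Sum>i<R. gB (s ! i) x) = real R *\<^sub>R gF x"
proof -
  have "(\<Sum>i<R. gB (s ! i) x) = (\<Sum>i<R. (1 / real n) *\<^sub>R (\<Sum>j\<in>s ! i. grad d (f j) x))"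
    using assms by (intro sum.cong refl grad_batch ordered_partition_nth_in_batches) auto
  also have "\<dots> = (1 / real n) *\<^sub>R (\<Sum>j=1..N. grad d (f j) x)"
    using sum_ordered_partition[OF assms(1), of "\<lambda>j. grad d (f j) x"] by (simp flip: scaleR_right.sum)
  also have "\<dots> = real R *\<^sub>R gF x"
    using assms n_pos R_pos by (simp add: grad_F N_eq)
  finally show ?thesis .
qed

lemma grad_F_lipschitz: "x \<in> Rd d \<Longrightarrow> y \<in> Rd d \<Longrightarrow> norm (gF x - gF y) \<le> L * norm (x - y)"
  using smooth_F by (auto simp: smooth_def)

text \<open>
  Strong convexity between the minimiser and the point reached by a gradient step of length \<open>1 / (2 L)\<close> from it
  shows that the gradients at the two points form no acute angle. By Lipschitz continuity they differ by at most
  half the norm of the first, which is therefore \<open>0\<close>.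
\<close>
lemma grad_F_Xs: "gF Xs = 0"
proof -
  define y where "y = Xs - (1 / (2 * L)) *\<^sub>R gF Xs"
  have y: "y \<in> Rd d"
    unfolding y_def by (intro subspace_diff subspace_scale subspace_Rd Xs grad_F_Rd)
  have d: "Xs - y = (1 / (2 * L)) *\<^sub>R gF Xs" by (simp add: y_def)
  have "F Xs \<ge> F y + inner (gF y) (Xs - y) + \<mu> / 2 * (norm (Xs - y))\<^sup>2"
    using convex_F Xs y by (auto simp: strongly_convex_def)
  moreover have "0 \<le> \<mu> / 2 * (norm (Xs - y))\<^sup>2" using \<mu>_pos by simp
  ultimately have "inner (gF y) (Xs - y) \<le> 0" using min[OF y] by linarith
  then have "inner (gF y) (gF Xs) \<le> 0" using L_pos by (simp add: d divide_le_0_iff)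
  then have "inner (gF Xs) (gF Xs) \<le> inner (gF Xs - gF y) (gF Xs)" by (simp add: inner_diff_left)
  also have "\<dots> \<le> norm (gF Xs - gF y) * norm (gF Xs)" by (rule norm_cauchy_schwarz)
  also have "\<dots> \<le> (L * norm (Xs - y)) * norm (gF Xs)"
    by (intro mult_right_mono grad_F_lipschitz Xs y) simp
  also have "\<dots> = inner (gF Xs) (gF Xs) / 2"
    using L_pos by (simp add: d power2_norm_eq_inner[symmetric] power2_eq_square)
  finally have "inner (gF Xs) (gF Xs) \<le> 0" by simp
  then show ?thesis by (meson inner_eq_zero_iff inner_ge_zero order_antisym)
qed

lemma norm_grad_F: "x \<in> Rd d \<Longrightarrow> norm (gF x) \<le> L * norm (x - Xs)"
  using grad_F_lipschitz[of x Xs] Xs grad_F_Xs by simp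

lemma sum_G: "s \<in> \<P> \<Longrightarrow> (\<Sum>i<R. G s i) = 0"
  using sum_grad_batch[OF _ Xs] grad_F_Xs by simp

lemma F_growth: "x \<in> Rd d \<Longrightarrow> \<mu> / 2 * (norm (x - Xs))\<^sup>2 \<le> F x - F Xs"
  using convex_F Xs grad_F_Xs by (fastforce simp: strongly_convex_def)

lemma inner_grad_F: "x \<in> Rd d \<Longrightarrow> F x - F Xs + \<mu> / 2 * (norm (x - Xs))\<^sup>2 \<le> inner (gF x) (x - Xs)"
proof -
  assume x: "x \<in> Rd d"
  have "F Xs \<ge> F x + inner (gF x) (Xs - x) + \<mu> / 2 * (norm (Xs - x))\<^sup>2"
    using convex_F Xs x by (auto simp: strongly_convex_def)
  then show ?thesis by (simp add: inner_diff_right norm_minus_commute)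
qed

text \<open>
  Convexity compares \<open>F\<close> with its linearisation at \<open>y\<close>, and moving the gradient from \<open>y\<close> to \<open>x\<close> costs the quadratic term.
  This yields \<open>L\<close> instead of the optimal \<open>L / 2\<close>, but requires no integration along the segment.
\<close>
lemma F_descent:
  assumes "x \<in> Rd d" "y \<in> Rd d"
  shows "F y \<le> F x + inner (gF x) (y - x) + L * (norm (y - x))\<^sup>2"
proof -
  have "F x \<ge> F y + inner (gF y) (x - y) + \<mu> / 2 * (norm (x - y))\<^sup>2"
    using convex_F assms by (auto simp: strongly_convex_def)
  moreover have "0 \<le> \<mu> / 2 * (norm (x - y))\<^sup>2" using \<mu>_pos by simp
  moreover have "inner (gF y - gF x) (y - x) \<le> L * (norm (y - x))\<^sup>2"
  proof -
    have "inner (gF y - gF x) (y - x) \<le> norm (gF y - gF x) * norm (y - x)" by (rule norm_cauchy_schwarz)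
    also have "\<dots> \<le> (L * norm (y - x)) * norm (y - x)"
      by (intro mult_right_mono grad_F_lipschitz assms) simp
    finally show ?thesis by (simp add: power2_eq_square)
  qed
  ultimately show ?thesis by (simp add: inner_diff_left inner_diff_right)
qed

lemma lyapunov_lower: "x \<in> Rd d \<Longrightarrow> \<mu> / 2 * (norm (x - Xs))\<^sup>2 + (norm v)\<^sup>2 / 4 \<le> V (x, v)"
  using F_growth[of x] energy_lower[of "F x - F Xs" v \<Gamma> "x - Xs"] by (simp add: lyapunov_eq_energy)

lemma lyapunov_nonneg: "x \<in> Rd d \<Longrightarrow> 0 \<le> V (x, v)"
proof -
  assume "x \<in> Rd d"
  moreover have "0 \<le> \<mu> / 2 * (norm (x - Xs))\<^sup>2 + (norm v)\<^sup>2 / 4" using \<mu>_pos by simp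
  ultimately show ?thesis using lyapunov_lower[of x v] by linarith
qed

lemma F_le_lyapunov: "F (fst z) - F Xs \<le> V z"
  using energy_lower[of "F (fst z) - F Xs" "snd z" \<Gamma> "fst z - Xs"] zero_le_power2[of "norm (snd z)"]
  unfolding lyapunov_eq_energy by linarith

lemma heavy_ball_Rd:
  assumes "x0 \<in> Rd d" "v0 \<in> Rd d" "\<And>i. i < k \<Longrightarrow> \<omega> i \<in> batches N n"
  shows "fst (heavy_ball d n f \<gamma> h x0 v0 \<omega> k) \<in> Rd d \<and> snd (heavy_ball d n f \<gamma> h x0 v0 \<omega> k) \<in> Rd d"
  using assms(3)
proof (induction k)
  case (Suc k)
  then show ?case
    by (auto simp: Let_def split_beta
        intro!: subspace_add subspace_diff subspace_scale subspace_Rd grad_batch_Rd)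
qed (use assms in auto)

lemma bound_const_ge: "2 \<le> A" "L \<le> A" "2 * \<gamma> \<le> A" "sqrt (2 / \<mu>) \<le> A" "L * sqrt (2 / \<mu>) \<le> A"
  using L_pos \<gamma>_pos \<mu>_pos unfolding bound_const_def by (auto simp: algebra_simps intro: add_nonneg_nonneg)

text \<open>
  The square root of the Lyapunov function measures the size of the state; for the position this uses strong convexity.
\<close>
lemma state_bounds:
  assumes "x \<in> Rd d"
  shows "norm (x - Xs) \<le> A * sqrt (V (x, v))" "norm v \<le> A * sqrt (V (x, v))"
    "norm (gF x) \<le> A * sqrt (V (x, v))"
proof -
  let ?W = "sqrt (V (x, v))"
  have V0: "0 \<le> V (x, v)" by (rule lyapunov_nonneg[OF assms])
  have nn: "0 \<le> \<mu> / 2 * (norm (x - Xs))\<^sup>2" "0 \<le> (norm v)\<^sup>2 / 4" using \<mu>_pos by auto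
  have "(norm (x - Xs))\<^sup>2 \<le> 2 / \<mu> * V (x, v)"
  proof -
    have "\<mu> / 2 * (norm (x - Xs))\<^sup>2 \<le> V (x, v)" using lyapunov_lower[OF assms, of v] nn by linarith
    then have "2 / \<mu> * (\<mu> / 2 * (norm (x - Xs))\<^sup>2) \<le> 2 / \<mu> * V (x, v)"
      using \<mu>_pos by (intro mult_left_mono) auto
    then show ?thesis using \<mu>_pos by simp
  qed
  then have "sqrt ((norm (x - Xs))\<^sup>2) \<le> sqrt (2 / \<mu> * V (x, v))" by (rule real_sqrt_le_mono)
  then have p: "norm (x - Xs) \<le> sqrt (2 / \<mu>) * ?W" by (simp only: real_sqrt_mult real_sqrt_abs abs_norm_cancel)
  have "(norm v)\<^sup>2 \<le> 4 * V (x, v)" using lyapunov_lower[OF assms, of v] nn by linarith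
  then have "sqrt ((norm v)\<^sup>2) \<le> sqrt (4 * V (x, v))" by (rule real_sqrt_le_mono)
  then have v: "norm v \<le> 2 * ?W" by (simp add: real_sqrt_mult)
  have W: "?W \<ge> 0" using V0 by simp
  show "norm (x - Xs) \<le> A * ?W" using p mult_right_mono[OF bound_const_ge(4) W] by linarith
  show "norm v \<le> A * ?W" using v mult_right_mono[OF bound_const_ge(1) W] by linarith
  have "norm (gF x) \<le> L * (sqrt (2 / \<mu>) * ?W)"
    using norm_grad_F[OF assms] mult_left_mono[OF p, of L] L_pos by linarith
  then show "norm (gF x) \<le> A * ?W"
    using mult_right_mono[OF bound_const_ge(5) W] by (simp add: mult.assoc)
qed

lemma lyapunov_decay:
  assumes "x \<in> Rd d"
  shows "rate * V (x, v) \<le> \<Gamma> * ((norm v)\<^sup>2 + inner (gF x) (x - Xs))"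
proof -
  let ?p = "(norm (x - Xs))\<^sup>2" and ?\<phi> = "F x - F Xs"
  have G: "\<gamma> \<le> \<Gamma>" "0 < \<Gamma>" using gamma_h_lower[OF h_pos, of \<gamma>] \<gamma>_pos by auto
  have r: "0 \<le> rate" "rate \<le> \<Gamma>" using G \<gamma>_pos \<mu>_pos by auto
  have "rate * \<Gamma>\<^sup>2 \<le> \<mu> * \<gamma> / \<Gamma>\<^sup>2 * \<Gamma>\<^sup>2" by (intro mult_right_mono) auto
  also have "\<dots> = \<mu> * \<gamma>" using G by simp
  also have "\<dots> \<le> \<mu> * \<Gamma>" using G \<mu>_pos by simp
  finally have rG: "rate * \<Gamma>\<^sup>2 / 2 * ?p \<le> \<Gamma> * (\<mu> / 2) * ?p"
    by (intro mult_right_mono) (auto simp: mult.commute)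
  have \<phi>: "0 \<le> ?\<phi>" using min[OF assms] by simp
  have "rate * V (x, v) \<le> rate * (?\<phi> + \<Gamma>\<^sup>2 / 2 * ?p + (norm v)\<^sup>2)"
    using energy_upper[of \<Gamma> ?\<phi> "x - Xs" v] r by (intro mult_left_mono) (auto simp: lyapunov_eq_energy)
  also have "\<dots> = rate * ?\<phi> + rate * \<Gamma>\<^sup>2 / 2 * ?p + rate * (norm v)\<^sup>2" by (simp add: algebra_simps)
  also have "\<dots> \<le> \<Gamma> * ?\<phi> + \<Gamma> * (\<mu> / 2) * ?p + \<Gamma> * (norm v)\<^sup>2"
    using r \<phi> by (intro add_mono[OF add_mono[OF mult_right_mono rG] mult_right_mono]) auto
  also have "\<dots> = \<Gamma> * ((norm v)\<^sup>2 + (?\<phi> + \<mu> / 2 * ?p))" by (simp add: algebra_simps)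
  also have "\<dots> \<le> \<Gamma> * ((norm v)\<^sup>2 + inner (gF x) (x - Xs))"
    using inner_grad_F[OF assms] G by (intro mult_left_mono add_left_mono) auto
  finally show ?thesis .
qed

lemma sum_append_nth:
  fixes a :: "nat set \<Rightarrow> 'b::comm_monoid_add"
  assumes "length s = R" "j \<le> R"
  shows "(\<Sum>i<R + j. a ((s @ s') ! i)) = (\<Sum>i<R. a (s ! i)) + (\<Sum>i<j. a (s' ! i))"
  using assms by (induction j) (auto simp: nth_append add.assoc intro!: sum.cong)

text \<open>
  The two strategies are treated differently: in general the linear noise is kept for averaging and its
  square is of order \<open>q\<^sup>2\<close>, whereas for balanced partial sums it is so small that it joins the Euler error.
\<close>
lemma run_drift:
  assumes z: "fst z \<in> Rd d" "snd z \<in> Rd d" and s: "s \<in> \<P>" "s' \<in> \<P>"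
    and T: "2 * A * T \<le> 1" and eps: "\<epsilon> > 0" and K: "K = drift_const \<mu> L \<gamma> \<epsilon>"
    and l: "l = s @ s'"
  defines "\<rho> \<equiv> 1 - T * rate / 2 + \<epsilon> * T + K * T\<^sup>2" and "q \<equiv> h\<^sup>2 * batch_noise l"
  shows "fst (run l z) \<in> Rd d" "snd (run l z) \<in> Rd d"
    and "V (run l z) \<le> \<rho> * V z - linear_noise z l + K * (T * q\<^sup>2 + (2 * A * q)\<^sup>2)"
    and "(\<Sum>k<2 * R. \<Sum>i<k. G l i) = 0 \<Longrightarrow> V (run l z) \<le> \<rho> * V z + K * T * q\<^sup>2"
proof -
  define hb where "hb k = heavy_ball d n f \<gamma> h (fst z) (snd z) (\<lambda>k. l ! k) k" for k
  define x v where "x k = fst (hb k)" and "v k = snd (hb k)" for k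
  have len: "length s = R" using s by (simp add: ordered_partitions_def)
  have lb: "l ! k \<in> batches N n" if "k < 2 * R" for k
    using that s len ordered_partition_nth_in_batches[of s N n R k]
      ordered_partition_nth_in_batches[of s' N n R "k - R"] by (simp add: l nth_append)
  have xv: "x k \<in> Rd d" "v k \<in> Rd d" if "k \<le> 2 * R" for k
    using heavy_ball_Rd[OF z, of k "\<lambda>k. l ! k"] lb that by (auto simp: x_def v_def hb_def)
  have x0: "x 0 = fst z" "v 0 = snd z" by (simp_all add: x_def v_def hb_def)
  have run: "run l z = (x (2 * R), v (2 * R))" by (simp add: run_def x_def v_def hb_def)
  then show "fst (run l z) \<in> Rd d" "snd (run l z) \<in> Rd d" using xv by auto
  have sum_l: "(\<Sum>i<2 * R. a (l ! i)) = (\<Sum>i<R. a (s ! i)) + (\<Sum>i<R. a (s' ! i))" for a :: "nat set \<Rightarrow> fseq"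
    using sum_append_nth[OF len order_refl, of a s'] by (simp add: l mult_2)
  note A = bound_const_ge
  have Ge: "\<gamma> \<le> \<Gamma>" by (rule gamma_h_lower[OF h_pos])
  have "1 \<le> real R" using R_pos by linarith
  then have "h \<le> T" using h_pos mult_left_mono[of 1 "real R" h] by simp
  then have "\<gamma> * h \<le> A * T" using A \<gamma>_pos h_pos by (intro mult_mono) auto
  moreover have "0 \<le> A * T" using A h_pos by simp
  ultimately have "\<gamma> * h \<le> 1" using T by linarith
  then have "\<Gamma> \<le> 2 * \<gamma>" by (rule gamma_h_upper[OF h_pos \<gamma>_pos])
  then have GA: "0 \<le> \<Gamma>" "\<Gamma> \<le> A" using A Ge \<gamma>_pos by auto
  interpret pp: perturbed_path x v "G l" "\<lambda>k. gB (l ! k) (x k) - G l k" "\<lambda>k. gB (l ! k) (x 0) - G l k"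
    "fst z - Xs" "gF (fst z)" h \<Gamma> \<eta> L "2 * R"
  proof
    show "h > 0" "\<Gamma> \<ge> 0" "L \<ge> 0" using h_pos GA L_pos by auto
    show "\<eta> * (1 + h * \<Gamma>) = 1" by (rule exp_gamma_h[OF h_pos])
    show "x (Suc k) = x k + h *\<^sub>R v (Suc k)" for k
      by (simp add: x_def v_def hb_def Let_def split_beta scaleR_diff_right power2_eq_square)
    show "v (Suc k) = \<eta> *\<^sub>R v k - h *\<^sub>R (G l k + (gB (l ! k) (x k) - G l k))" for k
      by (simp add: x_def v_def hb_def Let_def split_beta)
    show "norm (gB (l ! k) (x k) - G l k) \<le> L * (norm (fst z - Xs) + norm (x k - x 0))" if "k < 2 * R" for k
    proof -
      have "norm (gB (l ! k) (x k) - G l k) \<le> L * norm (x k - Xs)"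
        using smooth_batch[OF lb[OF that]] xv[of k] that Xs by (auto simp: smooth_def)
      also have "norm (x k - Xs) \<le> norm (fst z - Xs) + norm (x k - x 0)"
        using norm_triangle_ineq[of "x 0 - Xs" "x k - x 0"] by (simp add: x0)
      finally show ?thesis using L_pos by simp
    qed
    show "norm (gB (l ! k) (x k) - G l k - (gB (l ! k) (x 0) - G l k)) \<le> L * norm (x k - x 0)"
      if "k < 2 * R" for k
      using smooth_batch[OF lb[OF that]] xv[of k] xv[of 0] that by (auto simp: smooth_def)
    show "(\<Sum>k<2 * R. G l k) = 0" using sum_G[OF s(1)] sum_G[OF s(2)] sum_l[of "\<lambda>\<omega>. gB \<omega> Xs"] by simp
    then show "(\<Sum>k<2 * R. gB (l ! k) (x 0) - G l k) = real (2 * R) *\<^sub>R gF (fst z)"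
      using sum_grad_batch[OF s(1) xv(1)[of 0]] sum_grad_batch[OF s(2) xv(1)[of 0]]
        sum_l[of "\<lambda>\<omega>. gB \<omega> (fst z)"]
      by (simp add: sum_subtractf x0 flip: scaleR_add_left)
  qed
  have ppT: "pp.T = T" by (simp add: pp.T_def)
  have ppq: "pp.q = q" by (simp add: pp.q_def q_def batch_noise_def pp.P_def)
  define W where "W = sqrt (V z)"
  have Vz: "0 \<le> V z" using lyapunov_nonneg[OF z(1), of "snd z"] by simp
  have W: "0 \<le> W" "W\<^sup>2 = V z" using Vz by (auto simp: W_def)
  have bounds: "norm (fst z - Xs) \<le> A * W" "norm (snd z) \<le> A * W" "norm (gF (fst z)) \<le> A * W"
    using state_bounds[OF z(1), of "snd z"] by (auto simp: W_def)
  have A1: "1 \<le> A" using A by linarith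
  have T0: "0 \<le> T" using h_pos by simp
  have "1 * T \<le> 2 * A * T" by (rule mult_right_mono[OF _ T0]) (use A1 in linarith)
  then have TT: "0 \<le> T" "T \<le> 1" using T T0 by linarith+
  have q0: "0 \<le> q" using pp.q_nonneg ppq by simp
  have TG: "T * \<Gamma> \<le> 1"
    using pp.euler_errors(3)[OF A1 A(2) GA(2) _ W(1)] bounds T by (simp add: ppT x0)
  let ?nx = "position_noise \<eta> h (G l) (2 * R)" and ?nv = "momentum_noise \<eta> h (G l) (2 * R)"
  let ?e = "T\<^sup>2 * W + T * q"
  define ex where "ex = x (2 * R) + ?nx - x 0 - T *\<^sub>R v 0"
  define ev where "ev = v (2 * R) + ?nv - v 0 + T *\<^sub>R (\<Gamma> *\<^sub>R v 0 + gF (fst z))"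
  have ex: "norm ex \<le> 8 * A ^ 3 * ?e" and ev: "norm ev \<le> 8 * A ^ 3 * ?e"
    using pp.euler_errors(1,2)[OF A1 A(2) GA(2) _ W(1)] bounds T
    by (simp_all add: ppT ppq x0 ex_def ev_def)
  have nx: "norm ?nx \<le> 2 * q" using pp.norm_noise_x[of "2 * R"] TG by (simp add: ppT ppq)
  have nv: "norm ?nv \<le> \<Gamma> * q" using pp.norm_noise_v_final by (simp add: ppq)
  have A3: "A\<^sup>2 \<le> A ^ 3" "A \<le> A ^ 3"
    using A1 power_increasing[of 2 3 A] power_increasing[of 1 3 A] by auto
  have e0: "0 \<le> ?e" using TT W q0 by simp
  have E10: "8 * A ^ 3 * ?e \<le> 10 * A ^ 3 * ?e" using A1 e0 by (intro mult_right_mono) auto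
  have V_run: "V (run l z) = energy \<Gamma> (F (x (2 * R)) - F Xs) ((fst z - Xs) + (x (2 * R) - x 0)) (snd z + (v (2 * R) - v 0))"
    by (simp add: run lyapunov_eq_energy x0)
  have desc: "F (x (2 * R)) - F Xs \<le> F (fst z) - F Xs + inner (gF (fst z)) (x (2 * R) - x 0) + L * (norm (x (2 * R) - x 0))\<^sup>2"
    using F_descent[OF xv(1)[of 0] xv(1)[of "2 * R"]] by (simp add: x0)
  have decay: "rate * W\<^sup>2 \<le> \<Gamma> * ((norm (snd z))\<^sup>2 + inner (gF (fst z)) (fst z - Xs))"
    using lyapunov_decay[OF z(1), of "snd z"] by (simp add: W)
  have VW: "energy \<Gamma> (F (fst z) - F Xs) (fst z - Xs) (snd z) = W\<^sup>2"
    by (simp add: W lyapunov_eq_energy)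
  have E2: "2 * A\<^sup>2 \<le> 10 * A ^ 3" using A3 zero_le_power2[of A] by linarith
  have K': "K = 4 * A ^ 3 * (10 * A ^ 3) + 4 * A ^ 6 * (10 * A ^ 3)\<^sup>2 / \<epsilon> + 48 * A\<^sup>2 * (10 * A ^ 3)\<^sup>2"
    by (simp add: K drift_const_def Let_def)
  note drift = energy_drift[OF desc _ _ A1 A(2) GA TT W(1) VW bounds decay E2 q0 _ _ _ _ _ eps K']
  have q2: "2 * q \<le> 2 * A * q" "\<Gamma> * q \<le> 2 * A * q"
    using mult_right_mono[OF A1 q0] mult_right_mono[OF GA(2) q0] mult_nonneg_nonneg[of A q] A1 q0 by auto
  have "V (run l z) \<le> \<rho> * W\<^sup>2 - energy_deriv \<Gamma> (gF (fst z)) (fst z - Xs) (snd z) ?nx ?nv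
      + K * (T * q\<^sup>2 + (2 * A * q)\<^sup>2)"
    unfolding V_run \<rho>_def
  proof (rule drift)
    show "x (2 * R) - x 0 = T *\<^sub>R snd z - ?nx + ex" by (simp add: ex_def x0)
    show "v (2 * R) - v 0 = - T *\<^sub>R (\<Gamma> *\<^sub>R snd z + gF (fst z)) - ?nv + ev" by (simp add: ev_def x0)
    show "0 \<le> 2 * A * q" using A1 q0 by simp
  qed (use ex ev E10 nx nv q2 in linarith)+
  then show "V (run l z) \<le> \<rho> * V z - linear_noise z l + K * (T * q\<^sup>2 + (2 * A * q)\<^sup>2)"
    by (simp add: linear_noise_def W)
  show "V (run l z) \<le> \<rho> * V z + K * T * q\<^sup>2" if bal: "(\<Sum>k<2 * R. \<Sum>i<k. G l i) = 0"
  proof -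
    have "(\<Sum>k<2 * R. pp.P k) = 0" using bal by (simp add: pp.P_def)
    note bn = pp.balanced_noise_final[OF this, unfolded ppT ppq]
    have Tq: "0 \<le> T * q" using TT q0 by simp
    have "b \<le> 2 * (a + b)" if "0 \<le> a" "0 \<le> b" for a b :: real using that by simp
    then have "T * q \<le> 2 * ?e" using Tq mult_nonneg_nonneg[OF zero_le_power2[of T] W(1)] by blast
    then have half: "A ^ 3 * (T * q) \<le> A ^ 3 * (2 * ?e)" using A1 by (intro mult_left_mono) auto
    have "T * \<Gamma> * q \<le> A ^ 3 * (T * q)"
      using mult_right_mono[OF order_trans[OF GA(2) A3(2)] Tq] by (simp add: mult_ac)
    then have b1: "norm ?nx \<le> 2 * A ^ 3 * ?e" using bn(1) half by linarith
    have "\<Gamma>\<^sup>2 \<le> A ^ 3" using A3(1) power_mono[OF GA(2,1), of 2] by linarith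
    then have "T * \<Gamma>\<^sup>2 * q \<le> A ^ 3 * (T * q)"
      using mult_right_mono[OF _ Tq] by (fastforce simp: mult_ac)
    then have b2: "norm ?nv \<le> 2 * A ^ 3 * ?e" using bn(2) half by linarith
    have "V (run l z) \<le> \<rho> * W\<^sup>2 - energy_deriv \<Gamma> (gF (fst z)) (fst z - Xs) (snd z) 0 0
        + K * (T * q\<^sup>2 + 0\<^sup>2)"
      unfolding V_run \<rho>_def
    proof (rule drift)
      show "x (2 * R) - x 0 = T *\<^sub>R snd z - 0 + (ex - ?nx)" by (simp add: ex_def x0)
      show "v (2 * R) - v 0 = - T *\<^sub>R (\<Gamma> *\<^sub>R snd z + gF (fst z)) - 0 + (ev - ?nv)" by (simp add: ev_def x0)
      show "norm (ex - ?nx) \<le> 10 * A ^ 3 * ?e"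
        using norm_triangle_ineq4[of ex ?nx] ex b1 by linarith
      show "norm (ev - ?nv) \<le> 10 * A ^ 3 * ?e"
        using norm_triangle_ineq4[of ev ?nv] ev b2 by linarith
    qed simp_all
    then show ?thesis by (simp add: energy_deriv_def W)
  qed
qed

end

section \<open>Average over the batches of one pair of epochs\<close>

lemma sum_lessThan_add:
  fixes \<phi> :: "nat \<Rightarrow> 'a::comm_monoid_add"
  shows "(\<Sum>k<a + b. \<phi> k) = (\<Sum>k<a. \<phi> k) + (\<Sum>k<b. \<phi> (a + k))"
  by (induction b) (simp_all add: add.assoc)

lemma energy_deriv_sum:
  "(\<Sum>t\<in>S. energy_deriv \<Gamma> g p v (a t) (b t)) = energy_deriv \<Gamma> g p v (\<Sum>t\<in>S. a t) (\<Sum>t\<in>S. b t)"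
  by (simp add: energy_deriv_def inner_sum_right sum.distrib)

text \<open>
  Here \<open>W k z\<close> is the mean of \<open>v\<close> after \<open>k\<close> rounds from \<open>z\<close>, computed by conditioning on the first round. Since that round
  changes the starting point of the others, the induction is over all \<open>z\<close>. The number \<open>B\<close> is the
  fixed point of the affine recursion.
\<close>
lemma average_contraction:
  fixes W :: "nat \<Rightarrow> 'z \<Rightarrow> real"
  assumes W_0: "\<And>z. z \<in> S \<Longrightarrow> W 0 z = v z"
    and W_Suc: "\<And>k z. z \<in> S \<Longrightarrow> W (Suc k) z = (\<Sum>t\<in>\<Theta>. W k (\<Phi> t z)) / real (card \<Theta>)"
    and closed: "\<And>t z. t \<in> \<Theta> \<Longrightarrow> z \<in> S \<Longrightarrow> \<Phi> t z \<in> S"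
    and contr: "\<And>z. z \<in> S \<Longrightarrow> (\<Sum>t\<in>\<Theta>. v (\<Phi> t z)) / real (card \<Theta>) \<le> \<rho> * v z + (1 - \<rho>) * B"
    and \<Theta>: "finite \<Theta>" "\<Theta> \<noteq> {}" and "0 \<le> \<rho>" and z: "z \<in> S"
  shows "W k z \<le> \<rho> ^ k * v z + (1 - \<rho> ^ k) * B"
  using z
proof (induction k arbitrary: z)
  case 0 then show ?case by (simp add: W_0)
next
  case (Suc k)
  have c: "real (card \<Theta>) > 0" using \<Theta> by (simp add: card_gt_0_iff)
  have "W (Suc k) z \<le> (\<Sum>t\<in>\<Theta>. \<rho> ^ k * v (\<Phi> t z) + (1 - \<rho> ^ k) * B) / real (card \<Theta>)"
    unfolding W_Suc[OF Suc.prems] using Suc.IH closed[OF _ Suc.prems] by (intro divide_right_mono sum_mono) auto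
  also have "\<dots> = \<rho> ^ k * ((\<Sum>t\<in>\<Theta>. v (\<Phi> t z)) / real (card \<Theta>)) + (1 - \<rho> ^ k) * B"
    using c by (simp add: sum.distrib sum_distrib_left add_divide_distrib)
  also have "\<dots> \<le> \<rho> ^ k * (\<rho> * v z + (1 - \<rho>) * B) + (1 - \<rho> ^ k) * B"
    using contr[OF Suc.prems] \<open>0 \<le> \<rho>\<close> by (intro add_right_mono mult_left_mono) auto
  also have "\<dots> = \<rho> ^ Suc k * v z + (1 - \<rho> ^ Suc k) * B" by (simp add: algebra_simps)
  finally show ?case .
qed

lemma rr_batch_less:
  assumes "length s = R" "length s' = R" "i < 2 * R"
  shows "rr_batch R (case_nat s (case_nat s' \<xi>)) i = (s @ s') ! i"
proof (cases "i < R")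
  case False
  then have "i div R = 1" "i mod R = i - R" using assms by (simp_all add: div_nat_eqI mod_if)
  then show ?thesis using False assms by (simp add: rr_batch_def nth_append)
qed (use assms in \<open>simp add: rr_batch_def nth_append\<close>)

lemma rr_batch_add:
  assumes "R > 0" shows "rr_batch R (case_nat s (case_nat s' \<xi>)) (2 * R + i) = rr_batch R \<xi> i"
proof -
  have "(2 * R + i) div R = Suc (Suc (i div R))" using assms by simp
  moreover have "(2 * R + i) mod R = i mod R" by simp
  ultimately show ?thesis by (simp only: rr_batch_def) simp
qed

lemma sms_batch_less:
  assumes "length s = R" "i < 2 * R"
  shows "sms_batch R (case_nat s \<xi>) i = (s @ rev s) ! i"
proof (cases "i < R")
  case False
  then have "i div R = 1" "i mod R = i - R" using assms by (simp_all add: div_nat_eqI mod_if)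
  then show ?thesis using False assms by (simp add: sms_batch_def nth_append)
qed (use assms in \<open>simp add: sms_batch_def nth_append\<close>)

lemma sms_batch_add:
  assumes "R > 0" shows "sms_batch R (case_nat s \<xi>) (2 * R + i) = sms_batch R \<xi> i"
proof -
  have "(2 * R + i) div R = 2 + i div R" using assms by simp
  moreover have "(2 * R + i) mod R = i mod R" by simp
  ultimately show ?thesis by (simp only: sms_batch_def) simp
qed

context heavy_ball_problem begin

abbreviation "noise_var \<equiv> sigma_sq d N n f Xs"

lemma partitions_nonempty: "\<P> \<noteq> {}"
  using ordered_partitions_nonempty[OF n_pos] by (simp add: N_eq)

lemma card_partitions_pos: "real (card \<P>) > 0"
  using partitions_nonempty finite_ordered_partitions by (simp add: card_gt_0_iff)

lemma sum_norm_G: "i < R \<Longrightarrow> (\<Sum>s\<in>\<P>. (norm (G s i))\<^sup>2) = real (card \<P>) * noise_var"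
proof -
  assume i: "i < R"
  have ne: "batches N n \<noteq> {}"
    using partitions_nonempty ordered_partition_nth_in_batches[OF _ i, of _ N n] by blast
  interpret B: uniform_sequence "batches N n"
    by unfold_locales (use ne finite_batches in auto)
  show ?thesis
    using sum_ordered_partitions_nth[OF n_pos i ne, of "\<lambda>\<omega>. (norm (gB \<omega> Xs))\<^sup>2"]
    by (simp add: sigma_sq_def B.integral_U)
qed

lemma noise_var_nonneg: "0 \<le> noise_var"
proof -
  have "0 \<le> real (card \<P>) * noise_var"
    using sum_norm_G[OF R_pos] by (metis sum_nonneg zero_le_power2)
  then show ?thesis using card_partitions_pos by (simp add: zero_le_mult_iff)
qed

text \<open>
  Since the batch gradients at the minimiser add up to \<open>0\<close> over an epoch, the partial sums start afresh in the second epoch,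
  and the noise of a pair of epochs is controlled by the two epochs separately.
\<close>
definition epoch_noise :: "nat set list \<Rightarrow> real" where
  "epoch_noise s = (\<Sum>k<R. (norm (\<Sum>i<k. G s i))\<^sup>2)"

lemma sum_epoch_noise: "(\<Sum>s\<in>\<P>. epoch_noise s) \<le> real (card \<P>) * ((real R)\<^sup>2 * noise_var)"
proof -
  have "(\<Sum>s\<in>\<P>. epoch_noise s) = (\<Sum>k<R. \<Sum>s\<in>\<P>. (norm (\<Sum>i<k. G s i))\<^sup>2)"
    unfolding epoch_noise_def by (rule sum.swap)
  also have "\<dots> \<le> (\<Sum>k<R. real R * (real (card \<P>) * noise_var))"
  proof (rule sum_mono)
    fix k assume k: "k \<in> {..<R}"
    have "(\<Sum>s\<in>\<P>. (norm (\<Sum>i<k. G s i))\<^sup>2) \<le> real k * (real (card \<P>) * noise_var)"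
      by (rule sum_norm_partial_sum_le[where R = R]) (use sum_G sum_norm_G k in auto)
    also have "\<dots> \<le> real R * (real (card \<P>) * noise_var)"
      using k noise_var_nonneg by (intro mult_right_mono) auto
    finally show "(\<Sum>s\<in>\<P>. (norm (\<Sum>i<k. G s i))\<^sup>2) \<le> real R * (real (card \<P>) * noise_var)" .
  qed
  finally show ?thesis by (simp add: power2_eq_square algebra_simps)
qed

lemma length_partition: "s \<in> \<P> \<Longrightarrow> length s = R"
  by (simp add: ordered_partitions_def)

lemma batch_noise_le:
  assumes "s \<in> \<P>" "s' \<in> \<P>"
  shows "(batch_noise (s @ s'))\<^sup>2 \<le> 2 * real R * (epoch_noise s + epoch_noise s')"
proof -
  have len: "length s = R" using assms length_partition by simp
  have "(\<Sum>k<2 * R. (norm (\<Sum>i<k. G (s @ s') i))\<^sup>2)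
      = (\<Sum>k<R. (norm (\<Sum>i<k. G (s @ s') i))\<^sup>2) + (\<Sum>k<R. (norm (\<Sum>i<R + k. G (s @ s') i))\<^sup>2)"
    using sum_lessThan_add[of _ R R] by (simp add: mult_2)
  also have "(\<Sum>k<R. (norm (\<Sum>i<k. G (s @ s') i))\<^sup>2) = epoch_noise s"
    unfolding epoch_noise_def by (simp add: nth_append len)
  also have "(\<Sum>k<R. (norm (\<Sum>i<R + k. G (s @ s') i))\<^sup>2) = epoch_noise s'"
    unfolding epoch_noise_def
    using sum_append_nth[OF len, of _ "\<lambda>\<omega>. gB \<omega> Xs" s'] sum_G[OF assms(1)]
    by (intro sum.cong) auto
  finally show ?thesis
    using sum_squared_le_sum_of_squares[of "\<lambda>k. norm (\<Sum>i<k. G (s @ s') i)" "{..<2 * R}"]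
    by (simp add: batch_noise_def mult.commute)
qed

text \<open>
  The reversed second epoch makes the batch list a palindrome, so that the partial sums are antisymmetric about the middle of the pair.
\<close>
lemma symmetric_partial_sums:
  assumes "s \<in> \<P>"
  shows "(\<Sum>k<2 * R. \<Sum>i<k. G (s @ rev s) i) = 0"
proof -
  let ?l = "s @ rev s"
  let ?P = "\<lambda>k. \<Sum>i<k. G ?l i"
  have len: "length s = R" using assms length_partition by simp
  have sym: "?l ! (2 * R - Suc k) = ?l ! k" if "k < 2 * R" for k
  proof -
    have "rev ?l = ?l" by simp
    then have "?l ! k = rev ?l ! k" by simp
    then show ?thesis using that len by (subst (asm) rev_nth) (auto simp: mult_2)
  qed
  have P_R2: "?P (2 * R) = 0"
  proof -
    have "rev s \<in> \<P>" using assms by (simp add: ordered_partitions_def)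
    then show ?thesis
      using sum_append_nth[OF len order_refl, of "\<lambda>\<omega>. gB \<omega> Xs" "rev s"] sum_G assms by (simp add: mult_2)
  qed
  have refl: "?P (2 * R - k) = - ?P k" if "k \<le> 2 * R" for k
    using that
  proof (induction k)
    case (Suc k)
    have "2 * R - k = Suc (2 * R - Suc k)" using Suc.prems by simp
    then have "?P (2 * R - k) = ?P (2 * R - Suc k) + G ?l (2 * R - Suc k)" by simp
    then have "?P (2 * R - Suc k) = - ?P k - G ?l k" using Suc sym[of k] by (simp add: eq_diff_eq)
    then show ?case by simp
  qed (simp add: P_R2)
  have "(\<Sum>k\<le>2 * R. ?P k) = (\<Sum>k\<le>2 * R. ?P (2 * R - k))"
    by (rule sum.reindex_bij_witness[of _ "\<lambda>k. 2 * R - k" "\<lambda>k. 2 * R - k"]) auto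
  also have "\<dots> = (\<Sum>k\<le>2 * R. - ?P k)" by (rule sum.cong) (use refl in auto)
  also have "\<dots> = - (\<Sum>k\<le>2 * R. ?P k)" by (rule sum_negf)
  finally have "2 *\<^sub>R (\<Sum>k\<le>2 * R. ?P k) = 0" by (simp add: scaleR_2 eq_neg_iff_add_eq_0)
  then have "(\<Sum>k\<le>2 * R. ?P k) = 0" by simp
  moreover have "(\<Sum>k\<le>2 * R. ?P k) = (\<Sum>k<2 * R. ?P k) + ?P (2 * R)"
    using lessThan_Suc_atMost[of "2 * R"] sum.lessThan_Suc[of ?P "2 * R"] by simp
  ultimately show ?thesis using P_R2 by simp
qed

text \<open>
  The linear noise is a linear combination, with coefficients fixed by the state \<open>z\<close>, of batch gradients at the minimiser, and at
  each position these have mean zero.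
\<close>
lemma sum_linear_noise: "(\<Sum>(s, s')\<in>\<P> \<times> \<P>. linear_noise z (s @ s')) = 0"
proof -
  have zero: "(\<Sum>t\<in>\<P> \<times> \<P>. G (fst t @ snd t) i) = 0" if i: "i < 2 * R" for i
  proof (cases "i < R")
    case True
    have "(\<Sum>t\<in>\<P> \<times> \<P>. G (fst t @ snd t) i) = (\<Sum>t\<in>\<P> \<times> \<P>. G (fst t) i)"
      using True by (intro sum.cong) (auto simp: nth_append length_partition)
    also have "\<dots> = (\<Sum>s\<in>\<P>. \<Sum>s'\<in>\<P>. G s i)" by (simp add: sum.cartesian_product' split_beta)
    also have "\<dots> = real (card \<P>) *\<^sub>R (\<Sum>s\<in>\<P>. G s i)" by (simp add: sum_constant_scaleR scaleR_right.sum)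
    also have "\<dots> = 0" using sum_nth_eq_0[OF sum_G True] by simp
    finally show ?thesis .
  next
    case False
    have "(\<Sum>t\<in>\<P> \<times> \<P>. G (fst t @ snd t) i) = (\<Sum>t\<in>\<P> \<times> \<P>. G (snd t) (i - R))"
      using False by (intro sum.cong) (auto simp: nth_append length_partition)
    also have "\<dots> = (\<Sum>s\<in>\<P>. \<Sum>s'\<in>\<P>. G s' (i - R))" by (simp add: sum.cartesian_product' split_beta)
    also have "\<dots> = 0" using sum_nth_eq_0[where i = "i - R", OF sum_G] i False by simp
    finally show ?thesis .
  qed
  have "(\<Sum>t\<in>\<P> \<times> \<P>. linear_noise z (fst t @ snd t)) = 0"
    unfolding linear_noise_def energy_deriv_sum sum_momentum_noise sum_position_noise
    by (simp add: momentum_noise_eq_0 position_noise_eq_0 zero energy_deriv_def)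
  then show ?thesis by (simp add: split_beta)
qed

text \<open>
  The factor \<open>4 R\<^sup>3\<close> comes from the \<open>2 R\<close> terms in the Cauchy-Schwarz inequality, the two epochs, and the bound \<open>R\<^sup>2\<close> for the
  mean of the noise of one epoch.
\<close>
lemma rr_pair_average:
  assumes z: "fst z \<in> Rd d" "snd z \<in> Rd d"
    and T: "2 * A * T \<le> 1" and eps: "\<epsilon> > 0" and K: "K = drift_const \<mu> L \<gamma> \<epsilon>" "0 \<le> K"
  shows "(\<Sum>(s, s')\<in>\<P> \<times> \<P>. V (run (s @ s') z)) / real (card (\<P> \<times> \<P>))
    \<le> (1 - T * rate / 2 + \<epsilon> * T + K * T\<^sup>2) * V z + K * (T + 4 * A\<^sup>2) * (4 * h ^ 4 * (real R) ^ 3 * noise_var)"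
proof -
  let ?\<rho> = "1 - T * rate / 2 + \<epsilon> * T + K * T\<^sup>2" and ?p = "real (card \<P>)"
  let ?c = "K * (T + 4 * A\<^sup>2) * h ^ 4 * (2 * real R)"
  have "T \<ge> 0" using h_pos by simp
  then have c0: "0 \<le> ?c" using K h_pos by simp
  have "(\<Sum>(s, s')\<in>\<P> \<times> \<P>. V (run (s @ s') z))
      \<le> (\<Sum>(s, s')\<in>\<P> \<times> \<P>. ?\<rho> * V z - linear_noise z (s @ s') + ?c * (epoch_noise s + epoch_noise s'))"
  proof (rule sum_mono, clarify)
    fix s s' assume s: "s \<in> \<P>" "s' \<in> \<P>"
    have "K * (T * (h\<^sup>2 * batch_noise (s @ s'))\<^sup>2 + (2 * A * (h\<^sup>2 * batch_noise (s @ s')))\<^sup>2)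
        = K * (T + 4 * A\<^sup>2) * h ^ 4 * (batch_noise (s @ s'))\<^sup>2"
      by (simp add: power_mult_distrib algebra_simps flip: power_mult)
    also have "\<dots> \<le> K * (T + 4 * A\<^sup>2) * h ^ 4 * (2 * real R * (epoch_noise s + epoch_noise s'))"
      using K h_pos by (intro mult_left_mono batch_noise_le s) auto
    also have "\<dots> = ?c * (epoch_noise s + epoch_noise s')" by (simp only: mult.assoc)
    finally show "V (run (s @ s') z) \<le> ?\<rho> * V z - linear_noise z (s @ s') + ?c * (epoch_noise s + epoch_noise s')"
      by (rule order_trans[OF run_drift(3)[OF z s T eps K(1) refl] add_left_mono])
  qed
  also have "\<dots> = ?p * ?p * (?\<rho> * V z) + ?c * (\<Sum>(s, s')\<in>\<P> \<times> \<P>. epoch_noise s + epoch_noise s')"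
    using sum_linear_noise[of z]
    by (simp add: split_beta sum.distrib sum_subtractf card_cartesian_product flip: sum_distrib_left)
  also have "(\<Sum>(s, s')\<in>\<P> \<times> \<P>. epoch_noise s + epoch_noise s') = 2 * ?p * (\<Sum>s\<in>\<P>. epoch_noise s)"
    by (simp add: sum.cartesian_product[symmetric] sum.distrib flip: sum_distrib_left)
  also have "?c * (2 * ?p * (\<Sum>s\<in>\<P>. epoch_noise s)) \<le> ?c * (2 * ?p * (?p * ((real R)\<^sup>2 * noise_var)))"
    using sum_epoch_noise c0 by (intro mult_left_mono) auto
  finally have "(\<Sum>(s, s')\<in>\<P> \<times> \<P>. V (run (s @ s') z))
      \<le> ?p * ?p * (?\<rho> * V z) + ?c * (2 * ?p * (?p * ((real R)\<^sup>2 * noise_var)))" by simp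
  also have "\<dots> = (?\<rho> * V z + K * (T + 4 * A\<^sup>2) * (4 * h ^ 4 * (real R) ^ 3 * noise_var)) * (?p * ?p)"
  proof -
    have "p * p * v + k * t * e * (2 * r) * (2 * p * (p * (r\<^sup>2 * s))) = (v + k * t * (4 * e * r ^ 3 * s)) * (p * p)"
      for p v k t e r s :: real by (simp add: power2_eq_square power3_eq_cube algebra_simps)
    then show ?thesis .
  qed
  finally show ?thesis
    using card_partitions_pos by (subst pos_divide_le_eq) (auto simp: card_cartesian_product)
qed

lemma sms_pair_average:
  assumes z: "fst z \<in> Rd d" "snd z \<in> Rd d"
    and T: "2 * A * T \<le> 1" and eps: "\<epsilon> > 0" and K: "K = drift_const \<mu> L \<gamma> \<epsilon>" "0 \<le> K"
  shows "(\<Sum>s\<in>\<P>. V (run (s @ rev s) z)) / real (card \<P>)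
    \<le> (1 - T * rate / 2 + \<epsilon> * T + K * T\<^sup>2) * V z + K * T * (4 * h ^ 4 * (real R) ^ 3 * noise_var)"
proof -
  let ?\<rho> = "1 - T * rate / 2 + \<epsilon> * T + K * T\<^sup>2" and ?p = "real (card \<P>)"
  let ?c = "K * T * h ^ 4 * (2 * real R)"
  have c0: "0 \<le> ?c" using K h_pos by simp
  have "(\<Sum>s\<in>\<P>. V (run (s @ rev s) z)) \<le> (\<Sum>s\<in>\<P>. ?\<rho> * V z + ?c * (epoch_noise s + epoch_noise (rev s)))"
  proof (rule sum_mono)
    fix s assume s: "s \<in> \<P>"
    then have s': "rev s \<in> \<P>" by (simp add: ordered_partitions_def)
    have "K * T * (h\<^sup>2 * batch_noise (s @ rev s))\<^sup>2 = K * T * h ^ 4 * (batch_noise (s @ rev s))\<^sup>2"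
      by (simp add: power_mult_distrib flip: power_mult)
    also have "\<dots> \<le> K * T * h ^ 4 * (2 * real R * (epoch_noise s + epoch_noise (rev s)))"
      using K h_pos by (intro mult_left_mono batch_noise_le s s') auto
    also have "\<dots> = ?c * (epoch_noise s + epoch_noise (rev s))" by (simp only: mult.assoc)
    finally show "V (run (s @ rev s) z) \<le> ?\<rho> * V z + ?c * (epoch_noise s + epoch_noise (rev s))"
      by (rule order_trans[OF run_drift(4)[OF z s s' T eps K(1) refl symmetric_partial_sums[OF s]] add_left_mono])
  qed
  also have "\<dots> = ?p * (?\<rho> * V z) + ?c * (2 * (\<Sum>s\<in>\<P>. epoch_noise s))"
    using sum_ordered_partitions_rev[of epoch_noise N n R]
    by (simp add: sum.distrib flip: sum_distrib_left)
  also have "?c * (2 * (\<Sum>s\<in>\<P>. epoch_noise s)) \<le> ?c * (2 * (?p * ((real R)\<^sup>2 * noise_var)))"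
    using sum_epoch_noise c0 by (intro mult_left_mono) auto
  finally have "(\<Sum>s\<in>\<P>. V (run (s @ rev s) z)) \<le> ?p * (?\<rho> * V z) + ?c * (2 * (?p * ((real R)\<^sup>2 * noise_var)))" by simp
  also have "\<dots> = (?\<rho> * V z + K * T * (4 * h ^ 4 * (real R) ^ 3 * noise_var)) * ?p"
  proof -
    have "p * v + k * t * e * (2 * r) * (2 * (p * (r\<^sup>2 * s))) = (v + k * t * (4 * e * r ^ 3 * s)) * p"
      for p v k t e r s :: real by (simp add: power2_eq_square power3_eq_cube algebra_simps)
    then show ?thesis .
  qed
  finally show ?thesis
    using card_partitions_pos by (subst pos_divide_le_eq) auto
qed

end

section \<open>Iteration over the pairs of epochs\<close>

lemma depends_on_prefix_heavy_ball:
  assumes "\<And>\<xi> \<xi>' i. (\<forall>j<m. \<xi> j = \<xi>' j) \<Longrightarrow> i < k \<Longrightarrow> b \<xi> i = b \<xi>' i"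
  shows "depends_on_prefix m (\<lambda>\<xi>. \<phi> (heavy_ball d n f \<gamma> h x v (b \<xi>) k))"
  unfolding depends_on_prefix_def using assms by (metis heavy_ball_cong)

lemma depends_on_prefix_rr:
  "depends_on_prefix (2 * k) (\<lambda>\<xi>. \<phi> (heavy_ball d n f \<gamma> h x v (rr_batch R \<xi>) (2 * k * R)))"
  by (rule depends_on_prefix_heavy_ball) (simp add: rr_batch_def less_mult_imp_div_less)

lemma depends_on_prefix_sms:
  "depends_on_prefix k (\<lambda>\<xi>. \<phi> (heavy_ball d n f \<gamma> h x v (sms_batch R \<xi>) (2 * k * R)))"
proof (rule depends_on_prefix_heavy_ball)
  fix \<xi> \<xi>' :: "nat \<Rightarrow> nat set list" and i assume e: "\<forall>j<k. \<xi> j = \<xi>' j" and i: "i < 2 * k * R"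
  have "i div R div 2 < k" using less_mult_imp_div_less[OF i] by simp
  then show "sms_batch R \<xi> i = sms_batch R \<xi>' i" using e by (simp add: sms_batch_def)
qed

text \<open>
  The first summand dominates the error terms of both strategies as well as the \<open>O(T\<^sup>2)\<close> term of the drift. The summand \<open>A \<gamma>\<close>
  lets \<open>c > 0\<close> imply \<open>A h R < 1/4\<close>, which is the smallness of the step used throughout. The argument
  \<open>\<epsilon>\<close> of the drift constant is a quarter of a lower bound for the decay rate that is independent of \<open>h\<close>, obtained
  from \<open>gamma_h \<gamma> h \<le> 2 \<gamma>\<close>.
\<close>
definition error_const :: "real \<Rightarrow> real \<Rightarrow> real \<Rightarrow> real" where
  "error_const \<mu> L \<gamma> = (let A = bound_const \<mu> L \<gamma>
     in 8 * drift_const \<mu> L \<gamma> (min \<gamma> (\<mu> / (4 * \<gamma>)) / 4) * (1 + 4 * A\<^sup>2) + A * \<gamma>)"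

lemma drift_const_nonneg:
  assumes "\<gamma> > 0" "\<mu> > 0" "L > 0" "\<epsilon> > 0" shows "0 \<le> drift_const \<mu> L \<gamma> \<epsilon>"
proof -
  have "0 \<le> bound_const \<mu> L \<gamma>" using assms by (simp add: bound_const_def)
  then show ?thesis using assms(4) by (simp add: drift_const_def Let_def)
qed

lemma error_const_pos:
  assumes "\<gamma> > 0" "\<mu> > 0" "L > 0" shows "error_const \<mu> L \<gamma> > 0"
proof -
  have "0 < bound_const \<mu> L \<gamma>" using assms by (simp add: bound_const_def add_pos_nonneg)
  moreover have "0 \<le> drift_const \<mu> L \<gamma> (min \<gamma> (\<mu> / (4 * \<gamma>)) / 4)"
    using assms by (intro drift_const_nonneg) auto
  ultimately show ?thesis using assms unfolding error_const_def Let_def by (intro add_nonneg_pos) auto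
qed

context heavy_ball_problem begin

abbreviation "rr k z \<xi> \<equiv> heavy_ball d n f \<gamma> h (fst z) (snd z) (rr_batch R \<xi>) (2 * k * R)"
abbreviation "sms k z \<xi> \<equiv> heavy_ball d n f \<gamma> h (fst z) (snd z) (sms_batch R \<xi>) (2 * k * R)"

sublocale uniform_sequence \<P>
  by unfold_locales (use finite_ordered_partitions partitions_nonempty in auto)

lemma sampling_eq: "sampling N n R = M"
  by (simp add: sampling_def)

lemma heavy_ball_pair:
  assumes "\<And>i. i < 2 * R \<Longrightarrow> \<omega> i = l ! i" "\<And>i. \<omega> (2 * R + i) = \<omega>' i"
  shows "heavy_ball d n f \<gamma> h (fst z) (snd z) \<omega> (2 * Suc k * R)
    = heavy_ball d n f \<gamma> h (fst (run l z)) (snd (run l z)) \<omega>' (2 * k * R)"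
proof -
  have "2 * Suc k * R = 2 * R + 2 * k * R" by simp
  moreover have "heavy_ball d n f \<gamma> h (fst z) (snd z) \<omega> (2 * R) = run l z"
    unfolding run_def by (rule heavy_ball_cong) (rule assms(1))
  ultimately show ?thesis by (simp only: heavy_ball_add assms(2))
qed

lemma rr_Suc:
  assumes "s \<in> \<P>" "s' \<in> \<P>"
  shows "rr (Suc k) z (case_nat s (case_nat s' \<xi>)) = rr k (run (s @ s') z) \<xi>"
  by (rule heavy_ball_pair) (use assms R_pos in \<open>auto simp: rr_batch_less rr_batch_add length_partition\<close>)

lemma sms_Suc:
  assumes "s \<in> \<P>"
  shows "sms (Suc k) z (case_nat s \<xi>) = sms k (run (s @ rev s) z) \<xi>"
  by (rule heavy_ball_pair) (use assms R_pos in \<open>auto simp: sms_batch_less sms_batch_add length_partition\<close>)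

lemma integral_rr_Suc:
  fixes \<phi> :: "fseq \<times> fseq \<Rightarrow> real"
  shows "(\<integral>\<xi>. \<phi> (rr (Suc k) z \<xi>) \<partial>M)
    = (\<Sum>t\<in>\<P> \<times> \<P>. \<integral>\<xi>. \<phi> (rr k (run (fst t @ snd t) z) \<xi>) \<partial>M) / real (card (\<P> \<times> \<P>))"
proof -
  have dep: "depends_on_prefix (Suc (Suc (2 * k))) (\<lambda>\<xi>. \<phi> (rr (Suc k) z \<xi>))"
    using depends_on_prefix_rr[of "Suc k" \<phi>] by simp
  note dep1 = depends_on_prefix_case_nat[OF dep]
  note dep2 = depends_on_prefix_case_nat[OF dep1]
  have "(\<integral>\<xi>. \<phi> (rr (Suc k) z \<xi>) \<partial>M)
      = (\<Sum>s\<in>\<P>. \<integral>\<xi>. \<phi> (rr (Suc k) z (case_nat s \<xi>)) \<partial>M) / real (card \<P>)"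
    by (rule integral_peel(2)) (rule integrable_prefix[OF dep1])
  also have "(\<Sum>s\<in>\<P>. \<integral>\<xi>. \<phi> (rr (Suc k) z (case_nat s \<xi>)) \<partial>M)
      = (\<Sum>s\<in>\<P>. (\<Sum>s'\<in>\<P>. \<integral>\<xi>. \<phi> (rr (Suc k) z (case_nat s (case_nat s' \<xi>))) \<partial>M) / real (card \<P>))"
    by (intro sum.cong refl integral_peel(2)) (rule integrable_prefix[OF dep2])
  also have "\<dots> = (\<Sum>s\<in>\<P>. (\<Sum>s'\<in>\<P>. \<integral>\<xi>. \<phi> (rr k (run (s @ s') z) \<xi>) \<partial>M) / real (card \<P>))"
    by (intro sum.cong refl arg_cong2[where f = "(/)"]) (simp only: rr_Suc)
  also have "\<dots> / real (card \<P>)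
      = (\<Sum>t\<in>\<P> \<times> \<P>. \<integral>\<xi>. \<phi> (rr k (run (fst t @ snd t) z) \<xi>) \<partial>M) / real (card (\<P> \<times> \<P>))"
    by (simp add: sum.cartesian_product split_beta card_cartesian_product flip: sum_divide_distrib)
  finally show ?thesis .
qed

lemma integral_sms_Suc:
  fixes \<phi> :: "fseq \<times> fseq \<Rightarrow> real"
  shows "(\<integral>\<xi>. \<phi> (sms (Suc k) z \<xi>) \<partial>M)
    = (\<Sum>s\<in>\<P>. \<integral>\<xi>. \<phi> (sms k (run (s @ rev s) z) \<xi>) \<partial>M) / real (card \<P>)"
proof -
  note dep = depends_on_prefix_case_nat[OF depends_on_prefix_sms[of "Suc k" \<phi>]]
  have "(\<integral>\<xi>. \<phi> (sms (Suc k) z \<xi>) \<partial>M)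
      = (\<Sum>s\<in>\<P>. \<integral>\<xi>. \<phi> (sms (Suc k) z (case_nat s \<xi>)) \<partial>M) / real (card \<P>)"
    by (rule integral_peel(2)) (rule integrable_prefix[OF dep])
  also have "(\<Sum>s\<in>\<P>. \<integral>\<xi>. \<phi> (sms (Suc k) z (case_nat s \<xi>)) \<partial>M)
      = (\<Sum>s\<in>\<P>. \<integral>\<xi>. \<phi> (sms k (run (s @ rev s) z) \<xi>) \<partial>M)"
    by (intro sum.cong refl) (simp only: sms_Suc)
  finally show ?thesis .
qed

text \<open>
  What \<open>c > 0\<close> provides: a small step, and a contraction of each pair of epochs by at least \<open>1 - c h R\<close>. The decay
  \<open>h R m\<close> with \<open>m = rate\<close> loses at most half to \<open>\<epsilon> T\<close>, and the \<open>O(T\<^sup>2)\<close> term is paid for by \<open>C h R\<close> in \<open>c\<close>.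
\<close>
lemma step_constants:
  fixes c :: real
  defines "C \<equiv> error_const \<mu> L \<gamma>" and "\<epsilon> \<equiv> min \<gamma> (\<mu> / (4 * \<gamma>)) / 4"
  defines "K \<equiv> drift_const \<mu> L \<gamma> \<epsilon>"
  assumes c: "c = rate / 4 - C * h * real R" "c > 0"
  shows "2 * A * T \<le> 1" "T \<le> 1" "\<epsilon> > 0" "0 \<le> K" "8 * K * (1 + 4 * A\<^sup>2) \<le> C"
    and "0 \<le> 1 - c * h * real R"
    and "1 - T * rate / 2 + \<epsilon> * T + K * T\<^sup>2 \<le> 1 - c * h * real R"
proof -
  let ?t = "h * real R"
  have t: "?t > 0" using h_pos R_pos by simp
  show eps: "\<epsilon> > 0" using \<gamma>_pos \<mu>_pos by (simp add: \<epsilon>_def)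
  show K: "0 \<le> K" unfolding K_def using \<gamma>_pos \<mu>_pos L_pos eps by (rule drift_const_nonneg)
  have C: "C = 8 * K * (1 + 4 * A\<^sup>2) + A * \<gamma>" by (simp add: C_def error_const_def K_def \<epsilon>_def Let_def)
  have A: "2 \<le> A" "2 * \<gamma> \<le> A" using bound_const_ge by auto
  have A\<gamma>: "0 \<le> A * \<gamma>" using A \<gamma>_pos by simp
  have KA: "0 \<le> K * (1 + 4 * A\<^sup>2)" using K by simp
  show KC: "8 * K * (1 + 4 * A\<^sup>2) \<le> C" using C A\<gamma> by simp
  have "A * \<gamma> * ?t \<le> C * ?t" using C KA t by (intro mult_right_mono) auto
  also have "\<dots> < \<gamma> / 4" using c by (simp add: mult.assoc)
  finally have "\<gamma> * (A * ?t) < \<gamma> * (1 / 4)" by (simp add: mult_ac)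
  then have At: "A * ?t < 1 / 4" using \<gamma>_pos by (simp only: mult_less_cancel_left_pos)
  then show T2A: "2 * A * T \<le> 1" by (simp add: mult_ac)
  have At2: "2 * ?t \<le> A * ?t" "2 * \<gamma> * ?t \<le> A * ?t" using A t by (intro mult_right_mono; simp)+
  then show "T \<le> 1" using At by (simp add: mult_ac)
  have "0 \<le> C" using C KA A\<gamma> by linarith
  then have "0 \<le> C * ?t" using t by (rule mult_nonneg_nonneg[OF _ less_imp_le])
  moreover have "c = rate / 4 - C * ?t" "rate \<le> \<gamma>" using c(1) by (simp_all add: mult.assoc)
  moreover have "c \<le> \<gamma>" if "0 \<le> y" "c = r / 4 - y" "r \<le> \<gamma>" for r y using that \<gamma>_pos by simp
  ultimately have c0: "c \<le> \<gamma>" by blast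
  have "c * ?t \<le> \<gamma> * ?t" using c0 t by (intro mult_right_mono) auto
  then show "0 \<le> 1 - c * h * real R" using At At2(2) \<gamma>_pos t by (simp add: mult.assoc)
  have "\<gamma> * h \<le> \<gamma> * ?t" using \<gamma>_pos h_pos R_pos by simp
  moreover have "2 * (\<gamma> * ?t) \<le> A * ?t" using At2(2) by (simp only: mult.assoc)
  ultimately have "\<gamma> * h \<le> 1" using At by linarith
  then have G: "\<Gamma> \<le> 2 * \<gamma>" by (rule gamma_h_upper[OF h_pos \<gamma>_pos])
  have G0: "0 < \<Gamma>" using gamma_h_lower[OF h_pos, of \<gamma>] \<gamma>_pos by simp
  have "\<Gamma>\<^sup>2 \<le> (2 * \<gamma>)\<^sup>2" using G G0 by (intro power_mono) auto
  then have "\<mu> * \<gamma> / (2 * \<gamma>)\<^sup>2 \<le> \<mu> * \<gamma> / \<Gamma>\<^sup>2" using G0 \<mu>_pos \<gamma>_pos by (intro divide_left_mono) auto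
  moreover have "\<mu> * \<gamma> / (2 * \<gamma>)\<^sup>2 = \<mu> / (4 * \<gamma>)" using \<gamma>_pos by (simp add: power2_eq_square)
  ultimately have rate: "4 * \<epsilon> \<le> rate" by (auto simp: \<epsilon>_def)
  have "0 \<le> K * A\<^sup>2" using K by simp
  moreover have "8 * K * (1 + 4 * A\<^sup>2) = 8 * K + 32 * (K * A\<^sup>2)" by (simp add: algebra_simps)
  ultimately have "4 * K \<le> C" using KC K by linarith
  then have "4 * K * ?t\<^sup>2 \<le> C * ?t\<^sup>2" by (intro mult_right_mono) auto
  moreover have "2 * \<epsilon> * ?t + r / 4 * ?t \<le> r * ?t" if "4 * \<epsilon> \<le> r" for r
  proof -
    have "2 * \<epsilon> + r / 4 \<le> r" using that eps by linarith
    then show ?thesis using mult_right_mono[of _ r ?t] t by (fastforce simp: distrib_right)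
  qed
  note this[OF rate]
  moreover have "c * h * real R = rate / 4 * ?t - C * ?t\<^sup>2"
    unfolding c(1) by (simp add: power2_eq_square algebra_simps)
  moreover have "1 - T * rate / 2 + \<epsilon> * T + K * T\<^sup>2 = 1 - rate * ?t + 2 * \<epsilon> * ?t + 4 * K * ?t\<^sup>2"
    by (simp add: power2_eq_square)
  ultimately show "1 - T * rate / 2 + \<epsilon> * T + K * T\<^sup>2 \<le> 1 - c * h * real R"
    by argo
qed

lemma lyapunov_bounds:
  fixes c :: real
  defines "C \<equiv> error_const \<mu> L \<gamma>"
  assumes c: "c = rate / 4 - C * h * real R" "c > 0" and z: "fst z \<in> Rd d" "snd z \<in> Rd d"
  shows "(\<integral>\<xi>. V (rr k z \<xi>) \<partial>M) \<le> (1 - c * h * real R) ^ k * V z + C * h ^ 3 * (real R)\<^sup>2 * noise_var / c"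
    and "(\<integral>\<xi>. V (sms k z \<xi>) \<partial>M) \<le> (1 - c * h * real R) ^ k * V z + C * h ^ 4 * (real R) ^ 3 * noise_var / c"
proof -
  let ?\<rho> = "1 - c * h * real R" and ?S = "{z. fst z \<in> Rd d \<and> snd z \<in> Rd d}"
  define \<epsilon> where "\<epsilon> = min \<gamma> (\<mu> / (4 * \<gamma>)) / 4"
  define K where "K = drift_const \<mu> L \<gamma> \<epsilon>"
  note sc = step_constants[OF c(1)[unfolded C_def] c(2), folded C_def \<epsilon>_def K_def]
  have chR: "0 < c * h * real R" using c(2) h_pos R_pos by simp
  have C0: "0 \<le> C" using error_const_pos[OF \<gamma>_pos \<mu>_pos L_pos] by (simp add: C_def)
  have \<rho>V: "(1 - T * rate / 2 + \<epsilon> * T + K * T\<^sup>2) * V z \<le> ?\<rho> * V z" if "z \<in> ?S" for z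
    using sc(7) lyapunov_nonneg[of "fst z" "snd z"] that by (intro mult_right_mono) auto
  have pow: "(1 - ?\<rho> ^ k) * B \<le> B" if "0 \<le> B" for B k
    using that sc(6) by (intro mult_left_le_one_le) (use chR in \<open>auto intro: power_le_one\<close>)
  have s4: "0 \<le> h ^ 4 * (real R) ^ 3 * noise_var" using h_pos noise_var_nonneg by simp

  define B where "B = C * h ^ 3 * (real R)\<^sup>2 * noise_var / c"
  have B0: "0 \<le> B" using C0 h_pos noise_var_nonneg c(2) by (simp add: B_def)
  have B: "(1 - ?\<rho>) * B = C * (h ^ 4 * (real R) ^ 3 * noise_var)"
    using c(2) by (simp add: B_def power2_eq_square power3_eq_cube power4_eq_xxxx)
  have "(\<integral>\<xi>. V (rr k z \<xi>) \<partial>M) \<le> ?\<rho> ^ k * V z + (1 - ?\<rho> ^ k) * B"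
  proof (rule average_contraction[where S = ?S and \<Theta> = "\<P> \<times> \<P>" and \<Phi> = "\<lambda>t. run (fst t @ snd t)" and v = V])
    show "(\<integral>\<xi>. V (rr 0 z \<xi>) \<partial>M) = V z" for z
      by (simp add: P.prob_space)
    show "(\<integral>\<xi>. V (rr (Suc k) z \<xi>) \<partial>M)
      = (\<Sum>t\<in>\<P> \<times> \<P>. \<integral>\<xi>. V (rr k (run (fst t @ snd t) z) \<xi>) \<partial>M) / real (card (\<P> \<times> \<P>))" for k z
      by (rule integral_rr_Suc)
    show "run (fst t @ snd t) z \<in> ?S" if "t \<in> \<P> \<times> \<P>" "z \<in> ?S" for t z
      using that run_drift(1,2)[of z "fst t" "snd t" \<epsilon> K] sc K_def by auto
    show "finite (\<P> \<times> \<P>)" "\<P> \<times> \<P> \<noteq> {}" using finite_A nonempty_A by auto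
    show "0 \<le> ?\<rho>" by (rule sc(6))
    show "z \<in> ?S" using z by simp
    fix z assume zS: "z \<in> ?S"
    have "K * (T + 4 * A\<^sup>2) * (4 * h ^ 4 * (real R) ^ 3 * noise_var) \<le> K * (1 + 4 * A\<^sup>2) * (4 * h ^ 4 * (real R) ^ 3 * noise_var)"
      using sc(2,4) s4 by (intro mult_right_mono[OF mult_left_mono]) (simp_all add: mult.assoc)
    also have "\<dots> = 4 * K * (1 + 4 * A\<^sup>2) * (h ^ 4 * (real R) ^ 3 * noise_var)" by simp
    also have "\<dots> \<le> C * (h ^ 4 * (real R) ^ 3 * noise_var)"
    proof (rule mult_right_mono[OF _ s4])
      have "0 \<le> K * (1 + 4 * A\<^sup>2)" using sc(4) by simp
      then show "4 * K * (1 + 4 * A\<^sup>2) \<le> C" using sc(5) by simp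
    qed
    finally show "(\<Sum>t\<in>\<P> \<times> \<P>. V (run (fst t @ snd t) z)) / real (card (\<P> \<times> \<P>)) \<le> ?\<rho> * V z + (1 - ?\<rho>) * B"
      using rr_pair_average[of z \<epsilon> K] zS sc(1,3,4) \<rho>V[OF zS] K_def unfolding B by (simp add: split_beta)
  qed
  then show "(\<integral>\<xi>. V (rr k z \<xi>) \<partial>M) \<le> ?\<rho> ^ k * V z + C * h ^ 3 * (real R)\<^sup>2 * noise_var / c"
    using pow[OF B0, of k] by (simp add: B_def)

  define B' where "B' = C * h ^ 4 * (real R) ^ 3 * noise_var / c"
  have B0': "0 \<le> B'" using C0 h_pos noise_var_nonneg c(2) by (simp add: B'_def)
  have B': "(1 - ?\<rho>) * B' = C * (h * real R) * (h ^ 4 * (real R) ^ 3 * noise_var)"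
    using c(2) by (simp add: B'_def)
  have "(\<integral>\<xi>. V (sms k z \<xi>) \<partial>M) \<le> ?\<rho> ^ k * V z + (1 - ?\<rho> ^ k) * B'"
  proof (rule average_contraction[where S = ?S and \<Theta> = \<P> and \<Phi> = "\<lambda>s. run (s @ rev s)" and v = V])
    show "(\<integral>\<xi>. V (sms 0 z \<xi>) \<partial>M) = V z" for z
      by (simp add: P.prob_space)
    show "(\<integral>\<xi>. V (sms (Suc k) z \<xi>) \<partial>M)
      = (\<Sum>s\<in>\<P>. \<integral>\<xi>. V (sms k (run (s @ rev s) z) \<xi>) \<partial>M) / real (card \<P>)" for k z
      by (rule integral_sms_Suc)
    show "run (s @ rev s) z \<in> ?S" if "s \<in> \<P>" "z \<in> ?S" for s z
    proof -
      have "rev s \<in> \<P>" using that by (simp add: ordered_partitions_def)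
      then show ?thesis using that run_drift(1,2)[of z s "rev s" \<epsilon> K] sc K_def by auto
    qed
    show "finite \<P>" "\<P> \<noteq> {}" using finite_A nonempty_A by auto
    show "0 \<le> ?\<rho>" by (rule sc(6))
    show "z \<in> ?S" using z by simp
    fix z assume zS: "z \<in> ?S"
    have "K * T * (4 * h ^ 4 * (real R) ^ 3 * noise_var) = (8 * K) * ((h * real R) * (h ^ 4 * (real R) ^ 3 * noise_var))" by simp
    also have "\<dots> \<le> C * ((h * real R) * (h ^ 4 * (real R) ^ 3 * noise_var))"
    proof (rule mult_right_mono)
      have "0 \<le> K * A\<^sup>2" using sc(4) by simp
      then show "8 * K \<le> C" using sc(5) by (simp add: algebra_simps)
      show "0 \<le> h * real R * (h ^ 4 * (real R) ^ 3 * noise_var)" by (rule mult_nonneg_nonneg[OF _ s4]) (use h_pos in simp)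
    qed
    finally show "(\<Sum>s\<in>\<P>. V (run (s @ rev s) z)) / real (card \<P>) \<le> ?\<rho> * V z + (1 - ?\<rho>) * B'"
      using sms_pair_average[of z \<epsilon> K] zS sc(1,3,4) \<rho>V[OF zS] K_def unfolding B' by (simp add: mult.assoc)
  qed
  then show "(\<integral>\<xi>. V (sms k z \<xi>) \<partial>M) \<le> ?\<rho> ^ k * V z + C * h ^ 4 * (real R) ^ 3 * noise_var / c"
    using pow[OF B0', of k] by (simp add: B'_def)
qed

lemma F_le_expected_lyapunov:
  "(\<integral>\<xi>. F (fst (rr k z \<xi>)) - F Xs \<partial>M) \<le> (\<integral>\<xi>. V (rr k z \<xi>) \<partial>M)"
  "(\<integral>\<xi>. F (fst (sms k z \<xi>)) - F Xs \<partial>M) \<le> (\<integral>\<xi>. V (sms k z \<xi>) \<partial>M)"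
  by (rule integral_mono[OF _ _ F_le_lyapunov];
      rule integrable_prefix, rule depends_on_prefix_rr depends_on_prefix_sms)+

end

theorem theorem6p3:
  fixes \<mu> L \<gamma> :: real
  assumes "\<gamma> > 0" and "\<mu> > 0" and "L > 0"
  shows "\<exists>C>0. \<forall>(d::nat) (N::nat) (n::nat) (R::nat) (F :: fseq \<Rightarrow> real) (f :: nat \<Rightarrow> fseq \<Rightarrow> real)
      (Xs::fseq) (x0::fseq) (v0::fseq) (h::real) (c::real).
    N = n * R \<longrightarrow> n < N \<longrightarrow>
    (\<forall>i\<in>{1..N}. f i differentiable_on Rd d) \<longrightarrow>
    (\<forall>x\<in>Rd d. grad d F x = (1 / real N) *\<^sub>R (\<Sum>i=1..N. grad d (f i) x)) \<longrightarrow>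
    cont_diff d F \<longrightarrow> smooth d L F \<longrightarrow> strongly_convex d \<mu> F \<longrightarrow>
    Xs \<in> Rd d \<longrightarrow> (\<forall>x\<in>Rd d. F Xs \<le> F x) \<longrightarrow>
    (\<forall>\<omega>\<in>batches N n. cont_diff d (batch_fun n f \<omega>) \<and> cvx d (batch_fun n f \<omega>)
        \<and> smooth d L (batch_fun n f \<omega>)) \<longrightarrow>
    0 < h \<longrightarrow> h < min (1 / (2 * real R * \<gamma>)) (1 / (2 * real R * sqrt L)) \<longrightarrow>
    x0 \<in> Rd d \<longrightarrow> v0 \<in> Rd d \<longrightarrow>
    c = min \<gamma> (\<mu> * \<gamma> / (gamma_h \<gamma> h)\<^sup>2) / 4 - C * h * real R \<longrightarrow> c > 0 \<longrightarrow>
    (\<forall>k::nat.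
      (let M = sampling N n R;
           V = lyapunov F Xs \<gamma> h;
           z = (\<lambda>\<xi>. heavy_ball d n f \<gamma> h x0 v0 (rr_batch R \<xi>) (2 * k * R))
       in (\<integral>\<xi>. F (fst (z \<xi>)) - F Xs \<partial>M) \<le> (\<integral>\<xi>. V (z \<xi>) \<partial>M) \<and>
          (\<integral>\<xi>. V (z \<xi>) \<partial>M)
            \<le> (1 - c * h * real R) ^ k * V (x0, v0) + C * h^3 * (real R)\<^sup>2 * sigma_sq d N n f Xs / c) \<and>
      (let M = sampling N n R;
           V = lyapunov F Xs \<gamma> h;
           z = (\<lambda>\<xi>. heavy_ball d n f \<gamma> h x0 v0 (sms_batch R \<xi>) (2 * k * R))
       in (\<integral>\<xi>. F (fst (z \<xi>)) - F Xs \<partial>M) \<le> (\<integral>\<xi>. V (z \<xi>) \<partial>M) \<and>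
          (\<integral>\<xi>. V (z \<xi>) \<partial>M)
            \<le> (1 - c * h * real R) ^ k * V (x0, v0) + C * h^4 * (real R)^3 * sigma_sq d N n f Xs / c))"
proof (intro exI[of _ "error_const \<mu> L \<gamma>"] conjI allI impI)
  show "error_const \<mu> L \<gamma> > 0" using assms by (intro error_const_pos)
  fix d N n R :: nat and F :: "fseq \<Rightarrow> real" and f :: "nat \<Rightarrow> fseq \<Rightarrow> real"
    and Xs x0 v0 :: fseq and h c :: real and k :: nat
  assume H: "N = n * R" "n < N" "\<forall>i\<in>{1..N}. f i differentiable_on Rd d"
    "\<forall>x\<in>Rd d. grad d F x = (1 / real N) *\<^sub>R (\<Sum>i=1..N. grad d (f i) x)"
    "smooth d L F" "strongly_convex d \<mu> F" "Xs \<in> Rd d" "\<forall>x\<in>Rd d. F Xs \<le> F x"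
    "\<forall>\<omega>\<in>batches N n. cont_diff d (batch_fun n f \<omega>) \<and> cvx d (batch_fun n f \<omega>) \<and> smooth d L (batch_fun n f \<omega>)"
    "0 < h" "x0 \<in> Rd d" "v0 \<in> Rd d"
    "c = min \<gamma> (\<mu> * \<gamma> / (gamma_h \<gamma> h)\<^sup>2) / 4 - error_const \<mu> L \<gamma> * h * real R" "c > 0"
  interpret heavy_ball_problem \<mu> L \<gamma> d N n R F f Xs h
    by unfold_locales (use assms H in auto)
  note b = lyapunov_bounds[OF H(13,14), of "(x0, v0)" k] F_le_expected_lyapunov[of "(x0, v0)" k]
  show "let M = sampling N n R; V = lyapunov F Xs \<gamma> h;
        z = \<lambda>\<xi>. heavy_ball d n f \<gamma> h x0 v0 (rr_batch R \<xi>) (2 * k * R)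
      in (\<integral>\<xi>. F (fst (z \<xi>)) - F Xs \<partial>M) \<le> (\<integral>\<xi>. V (z \<xi>) \<partial>M) \<and>
         (\<integral>\<xi>. V (z \<xi>) \<partial>M) \<le> (1 - c * h * real R) ^ k * V (x0, v0)
           + error_const \<mu> L \<gamma> * h ^ 3 * (real R)\<^sup>2 * sigma_sq d N n f Xs / c"
    using b H(11,12) by (simp add: Let_def sampling_eq)
  show "let M = sampling N n R; V = lyapunov F Xs \<gamma> h;
        z = \<lambda>\<xi>. heavy_ball d n f \<gamma> h x0 v0 (sms_batch R \<xi>) (2 * k * R)
      in (\<integral>\<xi>. F (fst (z \<xi>)) - F Xs \<partial>M) \<le> (\<integral>\<xi>. V (z \<xi>) \<partial>M) \<and>
         (\<integral>\<xi>. V (z \<xi>) \<partial>M) \<le> (1 - c * h * real R) ^ k * V (x0, v0)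
           + error_const \<mu> L \<gamma> * h ^ 4 * (real R) ^ 3 * sigma_sq d N n f Xs / c"
    using b H(11,12) by (simp add: Let_def sampling_eq)
qed

end
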